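(* Let $\mathcal H=\bigoplus_{m\ge0}\mathcal H_m$ be a graded connected Hopf algebra over $\mathbb R$ (each $\mathcal H_m$ finite-dimensional) which is isomorphic as an algebra to the polynomial algebra $\mathbb R[x_1,x_2,\dots]$ on homogeneous generators $x_i$ of positive degrees, and let $\mathcal B$ be the basis of monomials $x_{i_1}\cdots x_{i_k}$. Fix $n$ and a probability distribution $P$ on weak-compositions of $n$ such that $\mathcal B$ is a state space basis for $P$, and let $\{X_t\}$ be the Markov chain on $\mathcal B_n$ driven by $m\Delta_P$, started at $x_0\in\mathcal B_n$. Let $A\subseteq\mathcal B_n$ be the set of products of $n$ generators of degree $1$. Then for every $t\ge1$, $$\mathrm{Prob}(X_t\in A)=\frac{n!}{\eta(x_0)}\big\langle \underbrace{S^P\cdot S^P\cdots S^P}_{t\text{ factors}},\ \chi(x_0)\big\rangle .$$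
   Context: $m$ is multiplication, $\Delta$ coproduct, $\Delta^{[l]}=(\Delta\otimes\mathrm{id}^{\otimes(l-2)})\circ\cdots\circ\Delta$; for a weak-composition $D=(d_1,\dots,d_l)$ of $n$ (non-negative integers summing to $n$), $\Delta_D$ is $\Delta^{[l]}$ followed by projection to $\mathcal H_{d_1}\otimes\cdots\otimes\mathcal H_{d_l}$; $m\Delta_P=\sum_D\frac{P(D)}{\binom nD}m\circ\Delta_D$ with $\binom nD=n!/\prod d_i!$. $\eta(x)$ is the sum of coefficients of $\Delta_{(1,\dots,1)}(x)$ in the basis $\{c_1\otimes\cdots\otimes c_{\deg x}:c_i\in\mathcal B_1\}$. State space basis for $P$: for each $D$ with $P(D)>0$, products of basis elements of degrees $d_1,\dots,d_l$ and $\Delta_D$ of basis elements have non-negative coefficients, and $\eta>0$ on $\mathcal B$. The chain driven by $m\Delta_P$ has transition matrix $\hat K(x,y)=\frac{\eta(y)}{\eta(x)}\cdot(\text{coefficient of }y\text{ in } m\Delta_P(x))$. Let $\zeta:\mathcal H\to\mathbb R$ be the algebra homomorphism with $\zeta(x_i)=1$ if $\deg x_i=1$ and $0$ otherwise. For $x\in\mathcal H_n$, $\chi(x):=\sum_{D}\zeta^{\otimes l(D)}(\Delta_D(x))\,M_D$, summing over (strict) compositions $D$ of $n$, where $M_D$ are the monomial quasisymmetric functions. $\mathbf{NSym}$ is the algebra of noncommutative symmetric functions with complete basis $S^D$ ($D$ a composition; for a weak-composition, $S^D$ means $S$ of $D$ with zero parts removed), paired with quasisymmetric functions by $\langle S^D,M_E\rangle=\delta_{D,E}$.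 $S^P:=\sum_D\frac{P(D)}{\binom nD}S^D$. The internal product on degree-$n$ elements is given by $S^I\cdot S^J=\sum_M S^{r(M)}$, summing over $l(I)\times l(J)$ matrices $M$ of non-negative integers with row sums $I$ and column sums $J$, where $r(M)$ is the weak-composition of the entries of $M$ read row by row. *)

theory Defs
  imports "HOL-Probability.Probability" "HOL-Library.Poly_Mapping" "HOL-Library.Multiset"
begin

section \<open>Free real vector spaces\<close>

instantiation poly_mapping :: (type, real_vector) real_vector
begin

lift_definition scaleR_poly_mapping :: "real \<Rightarrow> ('a \<Rightarrow>\<^sub>0 'b) \<Rightarrow> ('a \<Rightarrow>\<^sub>0 'b)"
  is "\<lambda>c f a. c *\<^sub>R f a"
  by (erule rev_finite_subset) auto

instance
  by standard (transfer; simp add: fun_eq_iff scaleR_add_right scaleR_add_left)+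

end

lemma lookup_scaleR: "Poly_Mapping.lookup (c *\<^sub>R p) a = c *\<^sub>R Poly_Mapping.lookup p a"
  by transfer simp


section \<open>Tensor powers of a real vector space\<close>

text \<open>The type \<open>'a tensor\<close> is the direct sum over all \<open>l\<close> of the \<open>l\<close>-fold tensor powers of \<open>'a\<close>:
  the free vector space on lists of vectors modulo multilinearity. The list
  \<open>[a\<^sub>1, \<dots>, a\<^sub>l]\<close> represents \<open>a\<^sub>1 \<otimes> \<dots> \<otimes> a\<^sub>l\<close>, and the \<open>0\<close>-fold tensor power is the line spanned by
  the empty tensor, i.e. the ground field.\<close>

definition multilinear_relations :: "('a::real_vector list \<Rightarrow>\<^sub>0 real) set" where
  "multilinear_relations =
     {Poly_Mapping.single (xs @ (a + b) # ys) 1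
        - Poly_Mapping.single (xs @ a # ys) 1 - Poly_Mapping.single (xs @ b # ys) 1 | xs a b ys. True}
   \<union> {Poly_Mapping.single (xs @ (c *\<^sub>R a) # ys) 1
        - c *\<^sub>R Poly_Mapping.single (xs @ a # ys) 1 | xs c a ys. True}"

definition tensor_rel :: "('a::real_vector list \<Rightarrow>\<^sub>0 real) \<Rightarrow> ('a list \<Rightarrow>\<^sub>0 real) \<Rightarrow> bool" where
  "tensor_rel p q \<longleftrightarrow> p - q \<in> span multilinear_relations"

lemma equivp_tensor_rel: "equivp (tensor_rel :: ('a::real_vector list \<Rightarrow>\<^sub>0 real) \<Rightarrow> _)"
proof (rule equivpI)
  show "reflp (tensor_rel :: ('a list \<Rightarrow>\<^sub>0 real) \<Rightarrow> _)" by (simp add: reflp_def tensor_rel_def span_zero)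
  show "symp (tensor_rel :: ('a list \<Rightarrow>\<^sub>0 real) \<Rightarrow> _)"
    unfolding symp_def tensor_rel_def by (metis minus_diff_eq span_neg)
  show "transp (tensor_rel :: ('a list \<Rightarrow>\<^sub>0 real) \<Rightarrow> _)"
    unfolding transp_def tensor_rel_def
  proof (intro allI impI)
    fix p q r :: "'a list \<Rightarrow>\<^sub>0 real"
    assume "p - q \<in> span multilinear_relations" "q - r \<in> span multilinear_relations"
    then have "(p - q) + (q - r) \<in> span multilinear_relations" by (rule span_add)
    then show "p - r \<in> span multilinear_relations" by simp
  qed
qed

quotient_type (overloaded) 'a tensor = "'a::real_vector list \<Rightarrow>\<^sub>0 real" / tensor_rel
  by (rule equivp_tensor_rel)

instantiation tensor :: (real_vector) real_vector
begin

lift_definition zero_tensor :: "'a tensor" is 0 .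

lift_definition plus_tensor :: "'a tensor \<Rightarrow> 'a tensor \<Rightarrow> 'a tensor" is "(+)"
  unfolding tensor_rel_def by (simp only: add_diff_add span_add)

lift_definition minus_tensor :: "'a tensor \<Rightarrow> 'a tensor \<Rightarrow> 'a tensor" is "(-)"
  unfolding tensor_rel_def 
proof -
  fix p p' q q' :: "'a list \<Rightarrow>\<^sub>0 real"
  assume "p - p' \<in> span multilinear_relations" "q - q' \<in> span multilinear_relations"
  then have "(p - p') - (q - q') \<in> span multilinear_relations" by (rule span_diff)
  then show "p - q - (p' - q') \<in> span multilinear_relations" by (simp add: algebra_simps)
qed

lift_definition uminus_tensor :: "'a tensor \<Rightarrow> 'a tensor" is uminus
  unfolding tensor_rel_def by (metis minus_diff_minus span_neg)

lift_definition scaleR_tensor :: "real \<Rightarrow> 'a tensor \<Rightarrow> 'a tensor" is "(*\<^sub>R)"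
  unfolding tensor_rel_def by (metis scaleR_diff_right span_scale)

instance
  by standard
    (transfer; simp add: tensor_rel_def span_zero scaleR_add_right scaleR_add_left algebra_simps)+

end

lift_definition pure :: "'a::real_vector list \<Rightarrow> 'a tensor" is "\<lambda>xs. Poly_Mapping.single xs 1" .

definition multilinear :: "('a::real_vector list \<Rightarrow> 'b::real_vector) \<Rightarrow> bool" where
  "multilinear f \<longleftrightarrow> (\<forall>xs ys. linear (\<lambda>a. f (xs @ a # ys)))"

definition tlift :: "('a::real_vector list \<Rightarrow> 'b::real_vector) \<Rightarrow> 'a tensor \<Rightarrow> 'b" where
  "tlift f = (THE g. linear g \<and> (\<forall>xs. g (pure xs) = f xs))"

text \<open>The universal property, which shows that \<open>tlift\<close> is well defined on multilinear maps.\<close>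

lemma span_pure: "span (range pure) = (UNIV :: 'a::real_vector tensor set)"
proof -
  have abs_sum: "abs_tensor (\<Sum>k\<in>A. f k) = (\<Sum>k\<in>A. abs_tensor (f k))"
    if "finite A" for A and f :: "'a list \<Rightarrow> 'a list \<Rightarrow>\<^sub>0 real"
    using that by induction (simp_all add: zero_tensor.abs_eq flip: plus_tensor.abs_eq)
  have "abs_tensor p \<in> span (range pure)" for p :: "'a list \<Rightarrow>\<^sub>0 real"
  proof -
    let ?q = "\<Sum>k\<in>Poly_Mapping.keys p. Poly_Mapping.lookup p k *\<^sub>R Poly_Mapping.single k 1"
    have "p = ?q"
      by (rule poly_mapping_eqI)
         (simp add: lookup_sum lookup_scaleR lookup_single when_def in_keys_iff if_distrib cong: if_cong)
    then have "abs_tensor p = abs_tensor ?q" by (rule arg_cong)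
    also have "\<dots> = (\<Sum>k\<in>Poly_Mapping.keys p. Poly_Mapping.lookup p k *\<^sub>R pure k)"
      by (simp add: abs_sum pure.abs_eq scaleR_tensor.abs_eq)
    finally have "abs_tensor p = (\<Sum>k\<in>Poly_Mapping.keys p. Poly_Mapping.lookup p k *\<^sub>R pure k)" .
    then show ?thesis by (simp add: span_base span_scale span_sum)
  qed
  then have "t \<in> span (range pure)" for t :: "'a tensor"
    by (induction t rule: tensor.abs_induct)
  then show ?thesis by blast
qed

lemma tlift_unique_existence:
  fixes f :: "'a::real_vector list \<Rightarrow> 'b::real_vector"
  assumes f: "multilinear f"
  shows "\<exists>!g. linear g \<and> (\<forall>xs. g (pure xs) = f xs)"
proof (rule ex_ex1I)
  define F where "F p = (\<Sum>xs\<in>Poly_Mapping.keys p. Poly_Mapping.lookup p xs *\<^sub>R f xs)" for p :: "'a list \<Rightarrow>\<^sub>0 real"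
  have F_eq: "F p = (\<Sum>xs\<in>A. Poly_Mapping.lookup p xs *\<^sub>R f xs)" if "finite A" "Poly_Mapping.keys p \<subseteq> A" for p A
    unfolding F_def using that by (intro sum.mono_neutral_left) (auto simp: in_keys_iff)
  have linF: "linear F"
  proof (rule linearI)
    fix p q :: "'a list \<Rightarrow>\<^sub>0 real" and c :: real
    have "Poly_Mapping.keys (p + q) \<subseteq> Poly_Mapping.keys p \<union> Poly_Mapping.keys q" by (rule keys_add)
    then show "F (p + q) = F p + F q"
      by (simp add: F_eq[of "Poly_Mapping.keys p \<union> Poly_Mapping.keys q"] lookup_add scaleR_left.add sum.distrib)
    have "Poly_Mapping.keys (c *\<^sub>R p) \<subseteq> Poly_Mapping.keys p" by (auto simp: in_keys_iff lookup_scaleR)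
    then show "F (c *\<^sub>R p) = c *\<^sub>R F p"
      by (simp add: F_eq[of "Poly_Mapping.keys p"] lookup_scaleR scaleR_sum_right)
  qed
  have F_single: "F (Poly_Mapping.single xs 1) = f xs" for xs by (simp add: F_def)
  have f_linear: "linear (\<lambda>a. f (xs @ a # ys))" for xs ys
    using f by (simp add: multilinear_def)
  have f_add: "f (xs @ (a + b) # ys) = f (xs @ a # ys) + f (xs @ b # ys)" for xs a b ys
    using linear_add[OF f_linear] .
  have f_scale: "f (xs @ (c *\<^sub>R a) # ys) = c *\<^sub>R f (xs @ a # ys)" for xs c a ys
    using linear_scale[OF f_linear] .
  have "F p = 0" if "p \<in> multilinear_relations" for p
    using that unfolding multilinear_relations_def
    by (auto simp: linear_diff[OF linF] linear_scale[OF linF] F_single f_add f_scale)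
  then have F0: "F p = 0" if "p \<in> span multilinear_relations" for p
    using linear_eq_0_on_span[OF linF _ that] by blast
  have "\<exists>g. \<forall>p. g (abs_tensor p) = F p"
  proof -
    have "F (rep_tensor (abs_tensor p)) = F p" for p
    proof -
      have "tensor_rel (rep_tensor (abs_tensor p)) p"
        by (rule rep_abs_rsp_left[OF Quotient3_tensor]) (simp add: tensor_rel_def span_zero)
      then show ?thesis
        using F0 unfolding tensor_rel_def by (metis eq_iff_diff_eq_0 linF linear_diff)
    qed
    then show ?thesis by (intro exI[of _ "\<lambda>t. F (rep_tensor t)"]) simp
  qed
  then obtain g where g: "\<And>p. g (abs_tensor p) = F p" by blast
  have "linear g"
  proof (rule linearI)
    show "g (s + t) = g s + g t" for s t
      by (induction s rule: tensor.abs_induct, induction t rule: tensor.abs_induct)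
         (simp add: plus_tensor.abs_eq g linear_add[OF linF])
    show "g (c *\<^sub>R t) = c *\<^sub>R g t" for c t
      by (induction t rule: tensor.abs_induct)
         (simp add: scaleR_tensor.abs_eq g linear_scale[OF linF])
  qed
  moreover have "g (pure xs) = f xs" for xs by (simp add: pure.abs_eq g F_single)
  ultimately show "\<exists>g. linear g \<and> (\<forall>xs. g (pure xs) = f xs)" by blast
next
  fix g h :: "'a tensor \<Rightarrow> 'b"
  assume g: "linear g \<and> (\<forall>xs. g (pure xs) = f xs)" and h: "linear h \<and> (\<forall>xs. h (pure xs) = f xs)"
  have "g t = h t" for t
    by (rule linear_eq_on_span[of g h "range pure"]) (use g h span_pure in auto)
  then show "g = h" by blast
qed

lemma tlift:
  assumes "multilinear f"
  shows linear_tlift: "linear (tlift f)" and tlift_pure: "tlift f (pure xs) = f xs"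
  using theI'[OF tlift_unique_existence[OF assms]] unfolding tlift_def by auto

definition tconcat :: "'a::real_vector tensor \<Rightarrow> 'a tensor \<Rightarrow> 'a tensor" where
  "tconcat s t = tlift (\<lambda>xs. tlift (\<lambda>ys. pure (xs @ ys)) t) s"

text \<open>\<open>tensor_maps [f\<^sub>1, \<dots>, f\<^sub>l]\<close> is \<open>f\<^sub>1 \<otimes> \<dots> \<otimes> f\<^sub>l\<close> on the \<open>l\<close>-fold tensor power (and zero on the
  others), where every \<open>f\<^sub>i\<close> may itself take values in an arbitrary tensor power; \<open>tid\<close> is the
  identity in this format.\<close>

definition tensor_maps :: "('a::real_vector \<Rightarrow> 'b::real_vector tensor) list \<Rightarrow> 'a tensor \<Rightarrow> 'b tensor" where
  "tensor_maps fs =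
     tlift (\<lambda>xs. if length xs = length fs
                 then foldr tconcat (map2 (\<lambda>f x. f x) fs xs) (pure []) else 0)"

definition tid :: "'a::real_vector \<Rightarrow> 'a tensor" where
  "tid x = pure [x]"

definition tmult :: "'a::real_algebra_1 tensor \<Rightarrow> 'a" where
  "tmult = tlift prod_list"

text \<open>The algebra structure \<open>(a\<^sub>1 \<otimes> \<dots> \<otimes> a\<^sub>l)(b\<^sub>1 \<otimes> \<dots> \<otimes> b\<^sub>l) = a\<^sub>1b\<^sub>1 \<otimes> \<dots> \<otimes> a\<^sub>lb\<^sub>l\<close> on each tensor power.\<close>

definition tensor_times :: "'a::real_algebra_1 tensor \<Rightarrow> 'a tensor \<Rightarrow> 'a tensor" where
  "tensor_times s t =
     tlift (\<lambda>xs. tlift (\<lambda>ys. if length xs = length ys then pure (map2 (*) xs ys) else 0) t) s"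


section \<open>Graded connected Hopf algebras\<close>

definition grading_decomposition :: "(nat \<Rightarrow> 'h::real_vector set) \<Rightarrow> 'h \<Rightarrow> (nat \<Rightarrow> 'h) \<Rightarrow> bool" where
  "grading_decomposition H x f \<longleftrightarrow>
     (\<forall>m. f m \<in> H m) \<and> finite {m. f m \<noteq> 0} \<and> x = (\<Sum>m | f m \<noteq> 0. f m)"

definition hcomponent :: "(nat \<Rightarrow> 'h::real_vector set) \<Rightarrow> nat \<Rightarrow> 'h \<Rightarrow> 'h" where
  "hcomponent H m x = (THE f. grading_decomposition H x f) m"

definition hdegree :: "(nat \<Rightarrow> 'h set) \<Rightarrow> 'h \<Rightarrow> nat" where
  "hdegree H x = (THE m. x \<in> H m)"

locale graded_connected_hopf_algebra =
  fixes H :: "nat \<Rightarrow> 'h::real_algebra_1 set"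
    and \<Delta> :: "'h \<Rightarrow> 'h tensor"
    and \<epsilon> :: "'h \<Rightarrow> real"
  assumes subspace_H: "\<And>m. subspace (H m)"
    and finite_dim_H: "\<And>m. \<exists>C. finite C \<and> H m = span C"
    and direct_sum: "\<And>x. \<exists>!f. grading_decomposition H x f"
    and one_in_H0: "1 \<in> H 0"
    and mult_graded: "\<And>i j x y. x \<in> H i \<Longrightarrow> y \<in> H j \<Longrightarrow> x * y \<in> H (i + j)"
    and connected: "H 0 = span {1}"
    and linear_coproduct: "linear \<Delta>"
    and coproduct_graded:
      "\<And>m x. x \<in> H m \<Longrightarrow> \<Delta> x \<in> span {pure [a, b] | a b i j. a \<in> H i \<and> b \<in> H j \<and> i + j = m}"
    and coassociative: "\<And>x. tensor_maps [\<Delta>, tid] (\<Delta> x) = tensor_maps [tid, \<Delta>] (\<Delta> x)"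
    and linear_counit: "linear \<epsilon>"
    and counit_graded: "\<And>m x. m > 0 \<Longrightarrow> x \<in> H m \<Longrightarrow> \<epsilon> x = 0"
    and counit_left: "\<And>x. tensor_maps [\<lambda>y. \<epsilon> y *\<^sub>R pure [], tid] (\<Delta> x) = tid x"
    and counit_right: "\<And>x. tensor_maps [tid, \<lambda>y. \<epsilon> y *\<^sub>R pure []] (\<Delta> x) = tid x"
    and coproduct_one: "\<Delta> 1 = pure [1, 1]"
    and coproduct_mult: "\<And>x y. \<Delta> (x * y) = tensor_times (\<Delta> x) (\<Delta> y)"
    and counit_one: "\<epsilon> 1 = 1"
    and counit_mult: "\<And>x y. \<epsilon> (x * y) = \<epsilon> x * \<epsilon> y"
    and antipode: "\<exists>S. linear S \<and> (\<forall>x. tmult (tensor_maps [tid \<circ> S, tid] (\<Delta> x)) = \<epsilon> x *\<^sub>R 1)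
                          \<and> (\<forall>x. tmult (tensor_maps [tid, tid \<circ> S] (\<Delta> x)) = \<epsilon> x *\<^sub>R 1)"

text \<open>The iterated coproduct; the \<open>0\<close>-fold one is the counit, the \<open>1\<close>-fold one is the identity.\<close>

fun coproduct_iter :: "('h::real_vector \<Rightarrow> 'h tensor) \<Rightarrow> ('h \<Rightarrow> real) \<Rightarrow> nat \<Rightarrow> 'h \<Rightarrow> 'h tensor" where
  "coproduct_iter \<Delta> \<epsilon> 0 x = \<epsilon> x *\<^sub>R pure []"
| "coproduct_iter \<Delta> \<epsilon> (Suc 0) x = tid x"
| "coproduct_iter \<Delta> \<epsilon> (Suc (Suc l)) x =
     tensor_maps (\<Delta> # replicate l tid) (coproduct_iter \<Delta> \<epsilon> (Suc l) x)"

definition coproduct_comp ::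
  "(nat \<Rightarrow> 'h::real_vector set) \<Rightarrow> ('h \<Rightarrow> 'h tensor) \<Rightarrow> ('h \<Rightarrow> real) \<Rightarrow> nat list \<Rightarrow> 'h \<Rightarrow> 'h tensor" where
  "coproduct_comp H \<Delta> \<epsilon> D x =
     tensor_maps (map (\<lambda>d. tid \<circ> hcomponent H d) D) (coproduct_iter \<Delta> \<epsilon> (length D) x)"


section \<open>Polynomial algebras and monomial bases\<close>

text \<open>\<open>'i multiset \<Rightarrow>\<^sub>0 real\<close> with its convolution product is the algebra of polynomials
  in commuting variables indexed by \<open>'i\<close>, a multiset of indices being a monomial.\<close>

definition polynomials :: "'i set \<Rightarrow> ('i multiset \<Rightarrow>\<^sub>0 real) set" where
  "polynomials I = {p. \<forall>M\<in>Poly_Mapping.keys p. set_mset M \<subseteq> I}"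

definition polynomial_generators :: "'i set \<Rightarrow> ('i \<Rightarrow> 'h::real_algebra_1) \<Rightarrow> bool" where
  "polynomial_generators I x \<longleftrightarrow>
     (\<exists>\<phi>. bij_betw \<phi> (polynomials I) UNIV
        \<and> (\<forall>p\<in>polynomials I. \<forall>q\<in>polynomials I. \<phi> (p + q) = \<phi> p + \<phi> q \<and> \<phi> (p * q) = \<phi> p * \<phi> q)
        \<and> (\<forall>p\<in>polynomials I. \<forall>c. \<phi> (c *\<^sub>R p) = c *\<^sub>R \<phi> p)
        \<and> \<phi> 1 = 1
        \<and> (\<forall>i\<in>I. \<phi> (Poly_Mapping.single {#i#} 1) = x i))"

definition monomials :: "'i set \<Rightarrow> ('i \<Rightarrow> 'h::monoid_mult) \<Rightarrow> 'h set" where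
  "monomials I x = {prod_list (map x is) | is. set is \<subseteq> I}"

definition algebra_hom :: "('h::real_algebra_1 \<Rightarrow> real) \<Rightarrow> bool" where
  "algebra_hom \<zeta> \<longleftrightarrow> linear \<zeta> \<and> \<zeta> 1 = 1 \<and> (\<forall>a b. \<zeta> (a * b) = \<zeta> a * \<zeta> b)"


section \<open>Chains driven by descent operators\<close>

definition weak_compositions :: "nat \<Rightarrow> nat list set" where
  "weak_compositions n = {D. sum_list D = n}"

definition compositions :: "nat \<Rightarrow> nat list set" where
  "compositions n = {D. sum_list D = n \<and> 0 \<notin> set D}"

definition multinomial_coeff :: "nat list \<Rightarrow> real" where
  "multinomial_coeff D = fact (sum_list D) / prod_list (map fact D)"

definition tensor_basis :: "(nat \<Rightarrow> 'h::real_vector set) \<Rightarrow> 'h set \<Rightarrow> nat list \<Rightarrow> 'h tensor set" where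
  "tensor_basis H B D = {pure cs | cs. list_all2 (\<lambda>c d. c \<in> B \<inter> H d) cs D}"

definition eta ::
  "(nat \<Rightarrow> 'h::real_vector set) \<Rightarrow> ('h \<Rightarrow> 'h tensor) \<Rightarrow> ('h \<Rightarrow> real) \<Rightarrow> 'h set \<Rightarrow> 'h \<Rightarrow> real" where
  "eta H \<Delta> \<epsilon> B x =
     (let D = replicate (hdegree H x) 1
      in \<Sum>c\<in>tensor_basis H B D. representation (tensor_basis H B D) (coproduct_comp H \<Delta> \<epsilon> D x) c)"

definition state_space_basis ::
  "(nat \<Rightarrow> 'h::real_algebra_1 set) \<Rightarrow> ('h \<Rightarrow> 'h tensor) \<Rightarrow> ('h \<Rightarrow> real) \<Rightarrow> 'h set \<Rightarrow> nat list pmf \<Rightarrow> bool" where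
  "state_space_basis H \<Delta> \<epsilon> B P \<longleftrightarrow>
     (\<forall>D. pmf P D > 0 \<longrightarrow>
        (\<forall>xs y. list_all2 (\<lambda>x d. x \<in> B \<inter> H d) xs D \<and> y \<in> B \<longrightarrow> representation B (prod_list xs) y \<ge> 0)
      \<and> (\<forall>x c. x \<in> B \<inter> H (sum_list D) \<and> c \<in> tensor_basis H B D \<longrightarrow>
             representation (tensor_basis H B D) (coproduct_comp H \<Delta> \<epsilon> D x) c \<ge> 0))
   \<and> (\<forall>x\<in>B. eta H \<Delta> \<epsilon> B x > 0)"

text \<open>There are infinitely many weak-compositions of \<open>n\<close>, and \<open>P\<close> may have infinite support, so the
  sum over them is taken coefficientwise in the finite-dimensional space \<open>H n\<close>.\<close>

definition descent_operator ::
  "(nat \<Rightarrow> 'h::real_algebra_1 set) \<Rightarrow> ('h \<Rightarrow> 'h tensor) \<Rightarrow> ('h \<Rightarrow> real) \<Rightarrow> 'h set \<Rightarrow> nat \<Rightarrow> nat list pmf \<Rightarrow> 'h \<Rightarrow> 'h" where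
  "descent_operator H \<Delta> \<epsilon> B n P x =
     (\<Sum>y\<in>B \<inter> H n. (\<Sum>\<^sub>\<infinity>D\<in>weak_compositions n. pmf P D / multinomial_coeff D *
          representation B (tmult (coproduct_comp H \<Delta> \<epsilon> D x)) y) *\<^sub>R y)"

definition transition_matrix ::
  "(nat \<Rightarrow> 'h::real_algebra_1 set) \<Rightarrow> ('h \<Rightarrow> 'h tensor) \<Rightarrow> ('h \<Rightarrow> real) \<Rightarrow> 'h set \<Rightarrow> nat \<Rightarrow> nat list pmf
     \<Rightarrow> 'h \<Rightarrow> 'h \<Rightarrow> real" where
  "transition_matrix H \<Delta> \<epsilon> B n P x y =
     eta H \<Delta> \<epsilon> B y / eta H \<Delta> \<epsilon> B x * representation B (descent_operator H \<Delta> \<epsilon> B n P x) y"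

definition markov_chain ::
  "'w measure \<Rightarrow> (nat \<Rightarrow> 'w \<Rightarrow> 's) \<Rightarrow> 's set \<Rightarrow> ('s \<Rightarrow> 's \<Rightarrow> real) \<Rightarrow> 's \<Rightarrow> bool" where
  "markov_chain M X \<S> K x\<^sub>0 \<longleftrightarrow>
     prob_space M
   \<and> (\<forall>t. X t \<in> measurable M (count_space \<S>))
   \<and> \<P>(\<omega> in M. X 0 \<omega> = x\<^sub>0) = 1
   \<and> (\<forall>t z. \<forall>y\<in>\<S>. \<P>(\<omega> in M. \<forall>s\<le>t. X s \<omega> = z s) > 0 \<longrightarrow>
        \<P>(\<omega> in M. X (Suc t) \<omega> = y \<bar> \<forall>s\<le>t. X s \<omega> = z s) = K (z t) y)"


section \<open>Quasisymmetric and noncommutative symmetric functions\<close>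

text \<open>Formal power series in variables \<open>X\<^sub>0, X\<^sub>1, \<dots>\<close> are functions from exponent vectors to
  coefficients.\<close>

type_synonym power_series = "(nat \<Rightarrow>\<^sub>0 nat) \<Rightarrow> real"

text \<open>\<open>M\<^sub>D\<close> is the sum of \<open>X\<^bsub>i\<^sub>1\<^esub>^d\<^sub>1 \<dots> X\<^bsub>i\<^sub>l\<^esub>^d\<^sub>l\<close> over \<open>i\<^sub>1 < \<dots> < i\<^sub>l\<close>; as the parts of \<open>D\<close>
  are positive, these monomials are distinct.\<close>

definition monomial_qsym :: "nat list \<Rightarrow> power_series" where
  "monomial_qsym D \<alpha> =
     (if \<exists>is. length is = length D \<and> sorted_wrt (<) is
           \<and> \<alpha> = (\<Sum>k<length D. Poly_Mapping.single (is ! k) (D ! k))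
      then 1 else 0)"

definition qsym_coords :: "power_series \<Rightarrow> (nat list \<Rightarrow>\<^sub>0 real)" where
  "qsym_coords f = (THE c. (\<forall>D\<in>Poly_Mapping.keys c. 0 \<notin> set D)
                         \<and> f = (\<lambda>\<alpha>. \<Sum>D\<in>Poly_Mapping.keys c. Poly_Mapping.lookup c D * monomial_qsym D \<alpha>))"

definition chi ::
  "(nat \<Rightarrow> 'h::real_algebra_1 set) \<Rightarrow> ('h \<Rightarrow> 'h tensor) \<Rightarrow> ('h \<Rightarrow> real) \<Rightarrow> ('h \<Rightarrow> real) \<Rightarrow> nat \<Rightarrow> 'h \<Rightarrow> power_series" where
  "chi H \<Delta> \<epsilon> \<zeta> n x =
     (\<lambda>\<alpha>. \<Sum>D\<in>compositions n.
        tlift (\<lambda>xs. prod_list (map \<zeta> xs)) (coproduct_comp H \<Delta> \<epsilon> D x) * monomial_qsym D \<alpha>)"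

text \<open>Noncommutative symmetric functions form the free algebra on \<open>S\<^sub>1, S\<^sub>2, \<dots>\<close>; they are given by
  their coefficients on the words \<open>S\<^sup>D\<close>, where \<open>D\<close> is a list of positive integers.\<close>

type_synonym nsym = "nat list \<Rightarrow>\<^sub>0 real"

definition complete_nsym :: "nat list \<Rightarrow> nsym" where
  "complete_nsym D = Poly_Mapping.single (filter (\<lambda>d. d \<noteq> 0) D) 1"

definition nsym_qsym_pairing :: "nsym \<Rightarrow> power_series \<Rightarrow> real" where
  "nsym_qsym_pairing a f = (\<Sum>D\<in>Poly_Mapping.keys a. Poly_Mapping.lookup a D * Poly_Mapping.lookup (qsym_coords f) D)"

definition margin_matrices :: "nat list \<Rightarrow> nat list \<Rightarrow> nat list list set" where
  "margin_matrices I J =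
     {M. length M = length I \<and> (\<forall>row\<in>set M. length row = length J)
       \<and> (\<forall>i<length I. (\<Sum>j<length J. M ! i ! j) = I ! i)
       \<and> (\<forall>j<length J. (\<Sum>i<length I. M ! i ! j) = J ! j)}"

definition internal_product :: "nsym \<Rightarrow> nsym \<Rightarrow> nsym" where
  "internal_product a b =
     (\<Sum>I\<in>Poly_Mapping.keys a. \<Sum>J\<in>Poly_Mapping.keys b. (Poly_Mapping.lookup a I * Poly_Mapping.lookup b J) *\<^sub>R
        (\<Sum>M\<in>margin_matrices I J. complete_nsym (concat M)))"

definition internal_power :: "nsym \<Rightarrow> nat \<Rightarrow> nsym" where
  "internal_power a t = ((\<lambda>b. internal_product b a) ^^ (t - 1)) a"

text \<open>As for the descent operator, the sum over all weak-compositions is taken coefficientwise.\<close>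

definition distribution_nsym :: "nat \<Rightarrow> nat list pmf \<Rightarrow> nsym" where
  "distribution_nsym n P =
     (\<Sum>E\<in>compositions n. (\<Sum>\<^sub>\<infinity>D\<in>weak_compositions n. pmf P D / multinomial_coeff D *
          Poly_Mapping.lookup (complete_nsym D) E) *\<^sub>R complete_nsym E)"

end

theory Submission
  imports Defs
begin

text \<open>
  Write \<open>\<pi>\<^sub>d\<close> for the projection onto \<open>H d\<close>. Then \<open>m \<circ> \<Delta>\<^sub>D\<close> is the convolution product
  \<open>\<pi>\<^bsub>d\<^sub>1\<^esub> \<star> \<dots> \<star> \<pi>\<^bsub>d\<^sub>l\<^esub>\<close>, with unit \<open>\<pi>\<^sub>0\<close>, so zero parts of \<open>D\<close> may be dropped. Since the product is
  commutative and \<open>\<Delta>\<close> is multiplicative, \<open>m \<circ> \<Delta>\<^sub>J\<close> applied to \<open>a b\<close> is the sum of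
  \<open>(m \<circ> \<Delta>\<^sub>K)(a) (m \<circ> \<Delta>\<^bsub>J-K\<^esub>)(b)\<close> over \<open>K \<le> J\<close>; splitting off the rows of a matrix one at a time this
  yields \<open>m \<circ> \<Delta>\<^sub>J \<circ> m \<circ> \<Delta>\<^sub>I = \<Sum>\<^sub>M m \<circ> \<Delta>\<^bsub>r(M)\<^esub>\<close>, i.e. the internal product acts by composition of
  operators. The same rule shows that \<open>\<eta>\<close> takes the value \<open>n!\<close> on products of \<open>n\<close> generators of
  degree one. On \<open>H n\<close> the functional \<open>\<zeta>\<close> is the sum of the coefficients over \<open>A\<close>, so the probability
  is \<open>n! / \<eta>(x\<^sub>0)\<close> times \<open>\<zeta>\<close> of the \<open>t\<close>-th iterate of the descent operator at \<open>x\<^sub>0\<close>, and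
  \<open>\<zeta> (m (\<Delta>\<^sub>D x))\<close> is the coefficient of \<open>M\<^sub>D\<close> in \<open>\<chi>(x)\<close>.
\<close>

section \<open>Multilinear maps on tensors\<close>

lemma linear_eq_on_tensor:
  assumes "linear f" "linear g" "\<And>xs. f (pure xs) = g (pure xs)"
  shows "f t = g t"
  by (rule linear_eq_on_span[of f g "range pure"]) (use assms span_pure in auto)

lemma pure_add: "pure (xs @ (a + b) # ys) = pure (xs @ a # ys) + pure (xs @ b # ys)"
proof transfer
  fix xs ys and a b :: 'a
  have "Poly_Mapping.single (xs @ (a + b) # ys) 1 - Poly_Mapping.single (xs @ a # ys) 1
      - Poly_Mapping.single (xs @ b # ys) (1::real) \<in> multilinear_relations"
    unfolding multilinear_relations_def by blast
  then show "tensor_rel (Poly_Mapping.single (xs @ (a + b) # ys) 1)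
      (Poly_Mapping.single (xs @ a # ys) 1 + Poly_Mapping.single (xs @ b # ys) 1)"
    unfolding tensor_rel_def by (metis diff_diff_eq span_base)
qed

lemma pure_scale: "pure (xs @ (c *\<^sub>R a) # ys) = c *\<^sub>R pure (xs @ a # ys)"
proof transfer
  fix xs ys c and a :: 'a
  have "Poly_Mapping.single (xs @ (c *\<^sub>R a) # ys) 1
      - c *\<^sub>R Poly_Mapping.single (xs @ a # ys) (1::real) \<in> multilinear_relations"
    unfolding multilinear_relations_def by blast
  then show "tensor_rel (Poly_Mapping.single (xs @ (c *\<^sub>R a) # ys) 1)
      (c *\<^sub>R Poly_Mapping.single (xs @ a # ys) 1)"
    unfolding tensor_rel_def by (rule span_base)
qed

lemma multilinear_pure: "multilinear pure"
  unfolding multilinear_def by (intro allI linearI) (simp_all add: pure_add pure_scale)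

lemma multilinearD: "multilinear f \<Longrightarrow> linear (\<lambda>a. f (xs @ a # ys))"
  by (simp add: multilinear_def)

lemma multilinear_append_left: "multilinear f \<Longrightarrow> multilinear (\<lambda>ys. f (xs @ ys))"
  unfolding multilinear_def
  by (intro allI, drule_tac x = "xs @ xsa" in spec) simp

lemma multilinear_append_right: "multilinear f \<Longrightarrow> multilinear (\<lambda>xs. f (xs @ ys))"
  unfolding multilinear_def
  by (intro allI, drule_tac x = xs in spec, drule_tac x = "ysa @ ys" in spec) simp

text \<open>Both sides of each linearity law are linear in \<open>t\<close>, so it is enough to
  compare them on pure tensors.\<close>

lemma linear_tlift_param:
  assumes "\<And>a. multilinear (F a)" "\<And>xs. linear (\<lambda>a. F a xs)"
  shows "linear (\<lambda>a. tlift (F a) t)"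
proof (rule linearI)
  fix a b :: 'a and c :: real
  note lin = linear_tlift[OF assms(1)]
  show "tlift (F (a + b)) t = tlift (F a) t + tlift (F b) t"
    by (rule linear_eq_on_tensor[OF lin linear_compose_add[OF lin lin]])
      (simp only: tlift_pure[OF assms(1)] linear_add[OF assms(2)])
  show "tlift (F (c *\<^sub>R a)) t = c *\<^sub>R tlift (F a) t"
    by (rule linear_eq_on_tensor[OF lin linear_compose_scale_right[OF lin]])
      (simp only: tlift_pure[OF assms(1)] linear_scale[OF assms(2)])
qed

lemma multilinear_tlift:
  assumes "\<And>xs. multilinear (F xs)" "\<And>ys. multilinear (\<lambda>xs. F xs ys)"
  shows "multilinear (\<lambda>xs. tlift (F xs) t)"
  unfolding multilinear_def
  by (intro allI linear_tlift_param assms(1) multilinearD[OF assms(2)])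

lemma tconcat_multilinear:
  "multilinear (\<lambda>ys. pure (xs @ ys))" "multilinear (\<lambda>xs. pure (xs @ ys))"
  by (rule multilinear_append_left[OF multilinear_pure] multilinear_append_right[OF multilinear_pure])+

text \<open>Serves \<open>tconcat\<close> and \<open>tensor_times\<close>, which are both two nested
  lifts of this shape; the inner lift is multilinear in the outer list by
  \<open>linear_tlift_param\<close>.\<close>

lemma bilinear_tlift2:
  assumes "\<And>xs. multilinear (F xs)" "\<And>ys. multilinear (\<lambda>xs. F xs ys)"
  shows "bilinear (\<lambda>s t. tlift (\<lambda>xs. tlift (F xs) t) s)"
  unfolding bilinear_def
proof (intro conjI allI)
  show "linear (\<lambda>s. tlift (\<lambda>xs. tlift (F xs) t) s)" for t
    by (rule linear_tlift[OF multilinear_tlift[OF assms]])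
  show "linear (\<lambda>t. tlift (\<lambda>xs. tlift (F xs) t) s)" for s
    by (rule linear_tlift_param[OF multilinear_tlift[OF assms] linear_tlift[OF assms(1)]])
qed

lemma tlift2_pure:
  assumes "\<And>xs. multilinear (F xs)" "\<And>ys. multilinear (\<lambda>xs. F xs ys)"
  shows "tlift (\<lambda>xs. tlift (F xs) (pure vs)) (pure us) = F us vs"
  by (simp only: tlift_pure[OF assms(1)] tlift_pure[OF assms(2)])

lemma bilinear_tconcat: "bilinear tconcat"
  unfolding tconcat_def[abs_def] by (rule bilinear_tlift2) (rule tconcat_multilinear)+

lemma tconcat_pure: "tconcat (pure xs) (pure ys) = pure (xs @ ys)"
  unfolding tconcat_def by (rule tlift2_pure) (rule tconcat_multilinear)+

lemma multilinear_tensor_times: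
  "multilinear (\<lambda>ys. if length xs = length ys then pure (map2 (*) xs ys) else (0::'a::real_algebra_1 tensor))"
  "multilinear (\<lambda>xs. if length xs = length ys then pure (map2 (*) xs ys) else (0::'a::real_algebra_1 tensor))"
proof -
  show "multilinear (\<lambda>ys. if length xs = length ys then pure (map2 (*) xs ys) else (0::'a tensor))" for xs :: "'a list"
    unfolding multilinear_def
  proof (intro allI)
    fix us vs :: "'a list"
    show "linear (\<lambda>a. if length xs = length (us @ a # vs) then pure (map2 (*) xs (us @ a # vs)) else 0)"
    proof (cases "length xs = Suc (length us + length vs)")
      case True
      \<comment> \<open>Cutting \<open>xs\<close> at the position of the varying entry isolates the
        single factor \<open>q\<close> that multiplies \<open>a\<close>.\<close>
      define p q r where "p = take (length us) xs" "q = xs ! length us" "r = drop (Suc (length us)) xs"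
      have "xs = p @ q # r" "length p = length us"
        using True by (auto simp: p_q_r_def id_take_nth_drop)
      then show ?thesis by (auto simp: algebra_simps pure_add pure_scale intro!: linearI)
    qed (auto intro: linear_zero)
  qed
  show "multilinear (\<lambda>xs. if length xs = length ys then pure (map2 (*) xs ys) else (0::'a tensor))" for ys :: "'a list"
    unfolding multilinear_def
  proof (intro allI)
    fix us vs :: "'a list"
    show "linear (\<lambda>a. if length (us @ a # vs) = length ys then pure (map2 (*) (us @ a # vs) ys) else 0)"
    proof (cases "length ys = Suc (length us + length vs)")
      case True
      define p q r where "p = take (length us) ys" "q = ys ! length us" "r = drop (Suc (length us)) ys"
      have "ys = p @ q # r" "length p = length us"
        using True by (auto simp: p_q_r_def id_take_nth_drop)
      then show ?thesis by (auto simp: algebra_simps pure_add pure_scale intro!: linearI)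
    qed (auto intro: linear_zero)
  qed
qed

lemma bilinear_tensor_times: "bilinear tensor_times"
  unfolding tensor_times_def[abs_def] by (rule bilinear_tlift2) (rule multilinear_tensor_times)+

lemma tensor_times_pure:
  "tensor_times (pure xs) (pure ys) = (if length xs = length ys then pure (map2 (*) xs ys) else 0)"
  unfolding tensor_times_def by (rule tlift2_pure) (rule multilinear_tensor_times)+

text \<open>Kept general in \<open>op\<close> because two folds are needed: concatenation of tensors
  for \<open>tensor_maps\<close>, multiplication for \<open>tprod\<close>.\<close>

lemma multilinear_foldr:
  fixes op :: "'b::real_vector \<Rightarrow> 'b \<Rightarrow> 'b"
  assumes op: "bilinear op" and gs: "\<forall>g\<in>set gs. linear g"
  shows "multilinear (\<lambda>xs. if length xs = length gs then foldr op (map2 (\<lambda>f x. f x) gs xs) e else 0)"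
  unfolding multilinear_def
proof (intro allI)
  fix xs ys :: "'a list"
  show "linear (\<lambda>a. if length (xs @ a # ys) = length gs
      then foldr op (map2 (\<lambda>f x. f x) gs (xs @ a # ys)) e else 0)"
    using gs
  proof (induction xs arbitrary: gs)
    case Nil
    show ?case
    proof (cases gs)
      case (Cons g gs')
      then have "linear g" using Nil by simp
      then have "linear (\<lambda>a. op (g a) z)" for z
        using linear_compose[of g "\<lambda>b. op b z"] op by (simp add: bilinear_def o_def)
      then show ?thesis using Cons linear_zero by (cases "length ys = length gs'") simp_all
    qed (auto intro: linear_zero)
  next
    case (Cons b xs)
    show ?case
    proof (cases gs)
      case (Cons g gs')
      then have lin: "linear (\<lambda>a. if length (xs @ a # ys) = length gs'
          then foldr op (map2 (\<lambda>f x. f x) gs' (xs @ a # ys)) e else 0)"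
        using Cons.IH[of gs'] Cons.prems by simp
      show ?thesis
      proof (cases "length gs' = Suc (length xs + length ys)")
        case True
        then have "linear (\<lambda>a. foldr op (map2 (\<lambda>f x. f x) gs' (xs @ a # ys)) e)" using lin by simp
        then show ?thesis using Cons True op
          linear_compose[of "\<lambda>a. foldr op (map2 (\<lambda>f x. f x) gs' (xs @ a # ys)) e" "op (g b)"]
          by (simp add: bilinear_def o_def)
      qed (use Cons in \<open>auto intro: linear_zero\<close>)
    qed (auto intro: linear_zero)
  qed
qed

lemma tensor_maps_pure:
  assumes "\<forall>g\<in>set gs. linear g"
  shows "tensor_maps gs (pure xs) = (if length xs = length gs
                 then foldr tconcat (map2 (\<lambda>f x. f x) gs xs) (pure []) else 0)"
  unfolding tensor_maps_def by (rule tlift_pure[OF multilinear_foldr[OF bilinear_tconcat assms]])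

lemma linear_tensor_maps:
  assumes "\<forall>g\<in>set gs. linear g"
  shows "linear (tensor_maps gs)"
  unfolding tensor_maps_def by (rule linear_tlift[OF multilinear_foldr[OF bilinear_tconcat assms]])

text \<open>The product map after the tensor product of the functions \<open>fs\<close>. The target
  is an arbitrary algebra: with values in the Hopf algebra it expresses convolutions, with values in
  \<open>real\<close> it gives the functionals dual to a basis of tensors.\<close>

definition tprod :: "('a::real_vector \<Rightarrow> 'b::real_algebra_1) list \<Rightarrow> 'a tensor \<Rightarrow> 'b" where
  "tprod fs = tlift (\<lambda>xs. if length xs = length fs then prod_list (map2 (\<lambda>f x. f x) fs xs) else 0)"

lemma bilinear_mult: "bilinear ((*) :: 'a::real_algebra_1 \<Rightarrow> 'a \<Rightarrow> 'a)"
  unfolding bilinear_def by (auto intro!: linearI simp: algebra_simps)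

lemma tprod_multilinear:
  fixes fs :: "('a::real_vector \<Rightarrow> 'b::real_algebra_1) list"
  assumes "\<forall>f\<in>set fs. linear f"
  shows "multilinear (\<lambda>xs. if length xs = length fs then prod_list (map2 (\<lambda>f x. f x) fs xs) else 0)"
  using multilinear_foldr[OF bilinear_mult assms, of 1] by (simp add: prod_list.eq_foldr cong: if_cong)

lemma tprod_pure:
  assumes "\<forall>f\<in>set fs. linear f"
  shows "tprod fs (pure xs) = (if length xs = length fs then prod_list (map2 (\<lambda>f x. f x) fs xs) else 0)"
  unfolding tprod_def by (rule tlift_pure[OF tprod_multilinear[OF assms]])

lemma linear_tprod:
  assumes "\<forall>f\<in>set fs. linear f"
  shows "linear (tprod fs)"
  unfolding tprod_def by (rule linear_tlift[OF tprod_multilinear[OF assms]])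

text \<open>The type \<open>tensor\<close> is the direct sum of all tensor powers, so the number of
  factors of an element has to be recorded separately.\<close>

definition tensor_power :: "nat \<Rightarrow> 'a::real_vector tensor set" where
  "tensor_power k = span {pure xs | xs. length xs = k}"

lemma pure_in_tensor_power: "length xs = k \<Longrightarrow> pure xs \<in> tensor_power k"
  unfolding tensor_power_def by (auto intro: span_base)

lemma bilinear_compose_linear:
  assumes "bilinear b" "linear f"
  shows "bilinear (\<lambda>s t. f (b s t))"
  unfolding bilinear_def
  by (intro conjI allI linearI)
    (simp_all add: bilinear_ladd[OF assms(1)] bilinear_radd[OF assms(1)] bilinear_lmul[OF assms(1)]
      bilinear_rmul[OF assms(1)] linear_add[OF assms(2)] linear_scale[OF assms(2)])

lemma bilinear_mult_linear:
  fixes f g :: "_ \<Rightarrow> 'b::real_algebra_1"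
  assumes "linear f" "linear g"
  shows "bilinear (\<lambda>s t. f s * g t)"
  unfolding bilinear_def
  by (intro conjI allI linearI)
    (simp_all add: algebra_simps linear_add[OF assms(1)] linear_add[OF assms(2)]
      linear_scale[OF assms(1)] linear_scale[OF assms(2)])

text \<open>By bilinearity only pure tensors need checking. The condition on \<open>s\<close> pins
  down where a concatenated list is cut: for a wrong length of \<open>s\<close> the right side
  vanishes, while the left side may not if \<open>t\<close> makes up the total length.\<close>

lemma tprod_tconcat:
  assumes fs: "\<forall>f\<in>set fs. linear f" and hs: "\<forall>f\<in>set hs. linear f"
    and s: "s \<in> tensor_power (length fs)"
  shows "tprod (fs @ hs) (tconcat s t) = tprod fs s * tprod hs t"
proof -
  have fshs: "\<forall>f\<in>set (fs @ hs). linear f" using fs hs by auto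
  note lin = linear_tprod[OF fshs] linear_tprod[OF fs] linear_tprod[OF hs]
  have L: "bilinear (\<lambda>s t. tprod (fs @ hs) (tconcat s t))"
    by (rule bilinear_compose_linear[OF bilinear_tconcat lin(1)])
  have R: "bilinear (\<lambda>s t. tprod fs s * tprod hs t)"
    by (rule bilinear_mult_linear[OF lin(2,3)])
  have gen: "tprod (fs @ hs) (tconcat s t) = tprod fs s * tprod hs t"
    if "s \<in> {pure xs | xs. length xs = length fs}" "t \<in> range pure" for s t
    using that by (auto simp: tconcat_pure tprod_pure[OF fs] tprod_pure[OF hs]
        tprod_pure[OF fshs])
  show ?thesis
    using s span_pure gen
    by (intro bilinear_eq[OF L R order_refl order_refl, of s _ t "range pure"]) (auto simp: tensor_power_def)
qed

text \<open>A product over a concatenated list is the product of the products over its blocks; each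
  \<open>g\<close> fills exactly the block of functions assigned to it. Through this lemma the
  tensor axioms of the Hopf algebra become identities between convolutions.\<close>

lemma tprod_tensor_maps:
  assumes "list_all2 (\<lambda>g fs. linear g \<and> (\<forall>x. g x \<in> tensor_power (length fs)) \<and> (\<forall>f\<in>set fs. linear f)) gs fss"
  shows "tprod (concat fss) (tensor_maps gs t) = tprod (map2 (\<lambda>g fs x. tprod fs (g x)) gs fss) t"
proof (rule linear_eq_on_tensor)
  have gs: "\<forall>g\<in>set gs. linear g" and fs: "\<forall>f\<in>set (concat fss). linear f"
    using assms by (induction rule: list_all2_induct) auto
  have gf: "\<forall>h\<in>set (map2 (\<lambda>g fs x. tprod fs (g x)) gs fss). linear h"
  proof
    fix h assume "h \<in> set (map2 (\<lambda>g fs x. tprod fs (g x)) gs fss)"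
    then obtain g fs' where "(g, fs') \<in> set (zip gs fss)" "h = (\<lambda>x. tprod fs' (g x))" by auto
    moreover from this have "linear g" "\<forall>f\<in>set fs'. linear f"
      using assms by (auto simp: list_all2_iff)
    ultimately show "linear h"
      using linear_compose[of g "tprod fs'"] linear_tprod[of fs'] by (simp add: o_def)
  qed
  show "linear (\<lambda>t. tprod (concat fss) (tensor_maps gs t))"
    using linear_compose[OF linear_tensor_maps[OF gs] linear_tprod[OF fs]] by (simp add: o_def)
  show "linear (tprod (map2 (\<lambda>g fs x. tprod fs (g x)) gs fss))"
    by (rule linear_tprod[OF gf])
  have len: "length gs = length fss" using assms by (rule list_all2_lengthD)
  fix xs
  have "tprod (concat fss) (foldr tconcat (map2 (\<lambda>f x. f x) gs xs) (pure []))
        = prod_list (map2 (\<lambda>f x. f x) (map2 (\<lambda>g fs x. tprod fs (g x)) gs fss) xs)"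
    if "length xs = length gs"
    using assms that
  proof (induction gs fss arbitrary: xs rule: list_all2_induct)
    case Nil
    then show ?case by (simp add: tprod_pure)
  next
    case (Cons g gs fs fss)
    then obtain y ys where "xs = y # ys" by (cases xs) auto
    moreover have "\<forall>h\<in>set (concat fss). linear h"
      using Cons.hyps(2) by (induction rule: list_all2_induct) auto
    ultimately show ?case using Cons.hyps Cons.IH[of ys] Cons.prems by (simp add: tprod_tconcat)
  qed
  then show "tprod (concat fss) (tensor_maps gs (pure xs)) = tprod (map2 (\<lambda>g fs x. tprod fs (g x)) gs fss) (pure xs)"
    by (simp add: tensor_maps_pure[OF gs] tprod_pure[OF gf] len linear_0[OF linear_tprod[OF fs]])
qed

section \<open>The convolution product\<close>

lemma multilinear_prod_list: "multilinear (prod_list :: 'a::real_algebra_1 list \<Rightarrow> 'a)"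
  unfolding multilinear_def by (auto intro!: linearI simp: algebra_simps)

lemma linear_tid: "linear tid"
  unfolding tid_def using multilinearD[OF multilinear_pure, of "[]" "[]"] by simp

lemma tprod_tid: "linear f \<Longrightarrow> tprod [f] (tid x) = f x"
  by (simp add: tid_def tprod_pure)

lemma tensor_power_scale: "t \<in> tensor_power k \<Longrightarrow> c *\<^sub>R t \<in> tensor_power k"
  unfolding tensor_power_def by (rule span_scale)

lemma linear_scaleR_pure: "linear f \<Longrightarrow> linear (\<lambda>y. f y *\<^sub>R pure xs)"
  by (auto intro!: linearI simp: linear_add linear_scale scaleR_left_distrib)

lemma tconcat_tid_list:
  "length xs = length fs \<Longrightarrow>
   foldr tconcat (map2 (\<lambda>f x. f x) (map ((\<circ>) tid) fs) xs) (pure []) = pure (map2 (\<lambda>f x. f x) fs xs)"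
  by (induction xs fs rule: list_induct2) (auto simp: tid_def tconcat_pure)

text \<open>Links the shape in which the operators are defined to \<open>tprod\<close>;
  \<open>tid\<close> only turns values into one-factor tensors, which multiplication undoes.\<close>

lemma tmult_tensor_maps:
  assumes fs: "\<forall>f\<in>set fs. linear f"
  shows "tmult (tensor_maps (map ((\<circ>) tid) fs) t) = tprod fs t"
proof (rule linear_eq_on_tensor)
  have fs': "\<forall>f\<in>set (map ((\<circ>) tid) fs). linear f"
    using fs by (auto intro!: linear_compose linear_tid)
  have lin: "linear tmult" unfolding tmult_def by (rule linear_tlift[OF multilinear_prod_list])
  show "linear (\<lambda>t. tmult (tensor_maps (map ((\<circ>) tid) fs) t))"
    using linear_compose[OF linear_tensor_maps[OF fs'] lin] by (simp add: o_def)
  show "linear (tprod fs)" by (rule linear_tprod[OF fs])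
  show "tmult (tensor_maps (map ((\<circ>) tid) fs) (pure xs)) = tprod fs (pure xs)" for xs
    by (simp add: tensor_maps_pure[OF fs'] tprod_pure[OF fs] tconcat_tid_list linear_0[OF lin]
        tmult_def tlift_pure[OF multilinear_prod_list] del: map_map)
      (simp add: linear_0[OF linear_tlift[OF multilinear_prod_list]])
qed

section \<open>Homogeneous components and the convolution algebra of linear endomorphisms\<close>

context graded_connected_hopf_algebra
begin

lemma grading_decomposition_hcomponent: "grading_decomposition H x (\<lambda>m. hcomponent H m x)"
  unfolding hcomponent_def using theI'[OF direct_sum[of x]] by simp

lemma hcomponent_in_H: "hcomponent H m x \<in> H m"
  using grading_decomposition_hcomponent[of x] by (simp add: grading_decomposition_def)

lemma finite_hcomponents: "finite {m. hcomponent H m x \<noteq> 0}"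
  using grading_decomposition_hcomponent[of x] by (simp add: grading_decomposition_def)

lemma sum_hcomponents: "(\<Sum>m | hcomponent H m x \<noteq> 0. hcomponent H m x) = x"
  using grading_decomposition_hcomponent[of x] by (simp add: grading_decomposition_def)

text \<open>Follows from uniqueness of the homogeneous decomposition. The index set \<open>A\<close>
  may contain degrees with zero term, so that several vectors can share one index set.\<close>

lemma hcomponent_eqI:
  assumes f: "\<And>m. f m \<in> H m" and A: "finite A" "\<And>m. m \<notin> A \<Longrightarrow> f m = 0" and x: "x = sum f A"
  shows "hcomponent H m x = f m"
proof -
  have sub: "{m. f m \<noteq> 0} \<subseteq> A" using A(2) by blast
  have "x = (\<Sum>m | f m \<noteq> 0. f m)"
    unfolding x by (rule sum.mono_neutral_right) (use A sub in auto)
  then have "grading_decomposition H x f"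
    using f finite_subset[OF sub A(1)] by (auto simp: grading_decomposition_def)
  then show ?thesis
    using direct_sum[of x] grading_decomposition_hcomponent[of x] by metis
qed

lemma linear_hcomponent: "linear (hcomponent H m)"
proof (rule linearI)
  fix x y :: 'h and c :: real
  let ?S = "\<lambda>x. {m. hcomponent H m x \<noteq> 0}"
  have sup: "x = (\<Sum>m\<in>A. hcomponent H m x)" if "finite A" "?S x \<subseteq> A" for A x
    by (subst sum_hcomponents[symmetric], rule sum.mono_neutral_left) (use that in auto)
  show "hcomponent H m (x + y) = hcomponent H m x + hcomponent H m y"
    by (rule hcomponent_eqI[where A = "?S x \<union> ?S y"])
      (use sup[of "?S x \<union> ?S y" x] sup[of "?S x \<union> ?S y" y] in
        \<open>auto simp: sum.distrib finite_hcomponents subspace_add[OF subspace_H] hcomponent_in_H\<close>)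
  show "hcomponent H m (c *\<^sub>R x) = c *\<^sub>R hcomponent H m x"
    by (rule hcomponent_eqI[where A = "?S x"])
      (auto simp: finite_hcomponents subspace_scale[OF subspace_H] hcomponent_in_H sum_hcomponents
        simp flip: scaleR_sum_right)
qed

lemma hcomponent_homogeneous: "x \<in> H k \<Longrightarrow> hcomponent H m x = (if m = k then x else 0)"
  by (rule hcomponent_eqI[where A = "{k}"]) (auto simp: subspace_0[OF subspace_H])

lemma linear_eq_on_graded:
  assumes "linear f" "linear g" "\<And>m x. x \<in> H m \<Longrightarrow> f x = g x"
  shows "f x = g x"
proof -
  have "f (\<Sum>m | hcomponent H m x \<noteq> 0. hcomponent H m x) = g (\<Sum>m | hcomponent H m x \<noteq> 0. hcomponent H m x)"
    by (simp add: linear_sum[OF assms(1)] linear_sum[OF assms(2)] assms(3)[OF hcomponent_in_H])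
  then show ?thesis by (simp add: sum_hcomponents)
qed

text \<open>In positive degree both sides vanish, and by connectedness degree 0 consists of
  multiples of 1, which both sides fix. Hence the projection to degree 0 is the neutral element of
  convolution.\<close>

lemma counit_eq_hcomponent: "\<epsilon> x *\<^sub>R 1 = hcomponent H 0 x"
proof (rule linear_eq_on_graded[of "\<lambda>x. \<epsilon> x *\<^sub>R 1" "hcomponent H 0"])
  show "linear (\<lambda>x. \<epsilon> x *\<^sub>R (1::'h))"
    using linear_counit by (auto intro!: linearI simp: linear_add linear_scale scaleR_left_distrib)
  show "linear (hcomponent H 0)" by (rule linear_hcomponent)
  fix m x assume x: "x \<in> H m"
  show "\<epsilon> x *\<^sub>R 1 = hcomponent H 0 x"
  proof (cases "m = 0")
    case True
    then obtain c where "x = c *\<^sub>R 1" using x connected by (auto simp: span_singleton)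
    then show ?thesis using x True
      by (simp add: hcomponent_homogeneous linear_scale[OF linear_counit] counit_one)
  next
    case False
    then show ?thesis using x by (simp add: hcomponent_homogeneous counit_graded)
  qed
qed

lemma coproduct_in_tensor_power: "\<Delta> x \<in> tensor_power 2"
proof -
  have "\<Delta> y \<in> tensor_power 2" if "y \<in> H m" for m y
    using coproduct_graded[OF that] unfolding tensor_power_def
    by (rule subsetD[OF span_mono, rotated]) auto
  then have "\<Delta> (\<Sum>m | hcomponent H m x \<noteq> 0. hcomponent H m x) \<in> tensor_power 2"
    unfolding linear_sum[OF linear_coproduct]
    using hcomponent_in_H unfolding tensor_power_def by (intro span_sum) blast
  then show ?thesis by (simp add: sum_hcomponents)
qed

definition convolution :: "('h \<Rightarrow> 'h) \<Rightarrow> ('h \<Rightarrow> 'h) \<Rightarrow> 'h \<Rightarrow> 'h" where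
  "convolution f g x = tprod [f, g] (\<Delta> x)"

lemma linear_convolution: "linear f \<Longrightarrow> linear g \<Longrightarrow> linear (convolution f g)"
  using linear_compose[OF linear_coproduct linear_tprod[of "[f, g]"]]
  by (simp add: convolution_def[abs_def] o_def)

text \<open>Coassociativity seen through \<open>tprod [f, g, h]\<close>, once with the blocks
  \<open>[[f, g], [h]]\<close> and once with \<open>[[f], [g, h]]\<close>.\<close>

lemma convolution_assoc:
  assumes "linear f" "linear g" "linear h"
  shows "convolution (convolution f g) h = convolution f (convolution g h)"
proof
  fix x
  have "tprod (concat [[f, g], [h]]) (tensor_maps [\<Delta>, tid] (\<Delta> x)) =
      tprod (map2 (\<lambda>g fs x. tprod fs (g x)) [\<Delta>, tid] [[f, g], [h]]) (\<Delta> x)"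
    by (rule tprod_tensor_maps)
      (use assms in \<open>auto simp: linear_coproduct linear_tid coproduct_in_tensor_power[simplified numeral_2_eq_2]
          tid_def pure_in_tensor_power\<close>)
  moreover have "tprod (concat [[f], [g, h]]) (tensor_maps [tid, \<Delta>] (\<Delta> x)) =
      tprod (map2 (\<lambda>g fs x. tprod fs (g x)) [tid, \<Delta>] [[f], [g, h]]) (\<Delta> x)"
    by (rule tprod_tensor_maps)
      (use assms in \<open>auto simp: linear_coproduct linear_tid coproduct_in_tensor_power[simplified numeral_2_eq_2]
          tid_def pure_in_tensor_power\<close>)
  ultimately show "convolution (convolution f g) h x = convolution f (convolution g h) x"
    using coassociative[of x] assms by (simp add: convolution_def[abs_def] tprod_tid)
qed

text \<open>The counit axiom seen through \<open>tprod\<close>: the counit owns an empty block,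
  whose product is 1, so the first factor becomes \<open>\<epsilon> y *\<^sub>R 1\<close>, the
  component of degree 0.\<close>

lemma convolution_unit_left:
  assumes "linear f"
  shows "convolution (hcomponent H 0) f = f"
proof
  fix x
  have "tprod (concat [[], [f]]) (tensor_maps [\<lambda>y. \<epsilon> y *\<^sub>R pure [], tid] (\<Delta> x)) =
      tprod (map2 (\<lambda>g fs x. tprod fs (g x)) [\<lambda>y. \<epsilon> y *\<^sub>R pure [], tid] [[], [f]]) (\<Delta> x)"
    by (rule tprod_tensor_maps)
      (use assms in \<open>auto simp: linear_tid linear_scaleR_pure linear_counit
          tid_def pure_in_tensor_power tensor_power_scale\<close>)
  then show "convolution (hcomponent H 0) f x = f x"
    using assms
    by (simp add: counit_left tprod_tid convolution_def linear_scale[OF linear_tprod] tprod_pure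
        counit_eq_hcomponent)
qed

lemma convolution_unit_right:
  assumes "linear f"
  shows "convolution f (hcomponent H 0) = f"
proof
  fix x
  have "tprod (concat [[f], []]) (tensor_maps [tid, \<lambda>y. \<epsilon> y *\<^sub>R pure []] (\<Delta> x)) =
      tprod (map2 (\<lambda>g fs x. tprod fs (g x)) [tid, \<lambda>y. \<epsilon> y *\<^sub>R pure []] [[f], []]) (\<Delta> x)"
    by (rule tprod_tensor_maps)
      (use assms in \<open>auto simp: linear_tid linear_scaleR_pure linear_counit
          tid_def pure_in_tensor_power tensor_power_scale\<close>)
  then show "convolution f (hcomponent H 0) x = f x"
    using assms
    by (simp add: counit_right tprod_tid convolution_def linear_scale[OF linear_tprod] tprod_pure
        counit_eq_hcomponent)
qed

definition convolution_list :: "('h \<Rightarrow> 'h) list \<Rightarrow> 'h \<Rightarrow> 'h" where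
  "convolution_list fs = foldr convolution fs (hcomponent H 0)"

lemma convolution_list_simps [simp]:
  "convolution_list [] = hcomponent H 0"
  "convolution_list (f # fs) = convolution f (convolution_list fs)"
  by (simp_all add: convolution_list_def)

lemma linear_convolution_list: "\<forall>f\<in>set fs. linear f \<Longrightarrow> linear (convolution_list fs)"
  by (induction fs) (auto intro: linear_convolution linear_hcomponent)

lemma convolution_list_append:
  assumes "\<forall>f\<in>set fs. linear f" "\<forall>f\<in>set gs. linear f"
  shows "convolution_list (fs @ gs) = convolution (convolution_list fs) (convolution_list gs)"
  using assms(1)
  by (induction fs)
    (simp_all add: convolution_unit_left convolution_assoc linear_convolution_list assms(2))

text \<open>The outermost coproduct of the iteration splits the first tensor factor, so it merges
  the first two functions into one convolution and shortens the list by one. This nests convolutions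
  to the left; associativity turns them into the right fold of
  \<open>convolution_list\<close>.\<close>

lemma tprod_coproduct_iter:
  assumes "\<forall>f\<in>set fs. linear f"
  shows "tprod fs (coproduct_iter \<Delta> \<epsilon> (length fs) x) = convolution_list fs x"
  using assms
proof (induction "length fs" arbitrary: fs)
  case 0
  then show ?case
    by (simp add: linear_scale[OF linear_tprod] tprod_pure counit_eq_hcomponent)
next
  case (Suc l)
  then obtain f fs' where fs: "fs = f # fs'" by (cases fs) auto
  show ?case
  proof (cases fs')
    \<comment> \<open>For length one the iterated coproduct is the identity, and the neutral element
      that ends the fold disappears.\<close>
    case Nil
    then show ?thesis using fs Suc.prems by (simp add: tprod_tid convolution_unit_right)
  next
    case (Cons g gs)
    have lin: "linear f" "linear g" "\<forall>f\<in>set gs. linear f" using Suc.prems fs Cons by auto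
    have l: "l = Suc (length gs)" using Suc.hyps(2) fs Cons by simp
    \<comment> \<open>The coproduct owns the two-element block \<open>[f, g]\<close>; each remaining
      function forms a block of its own under the identity.\<close>
    let ?gs = "\<Delta> # replicate (length gs) tid" and ?fss = "[f, g] # map (\<lambda>h. [h]) gs"
    have tids: "map2 (\<lambda>g fs x. tprod fs (g x)) (replicate (length gs) tid) (map (\<lambda>h. [h]) gs) = gs"
      using lin(3) by (induction gs) (auto simp: tprod_tid)
    have "list_all2 (\<lambda>g fs. linear g \<and> (\<forall>x. g x \<in> tensor_power (length fs)) \<and> (\<forall>f\<in>set fs. linear f)) ?gs ?fss"
      using lin
      by (auto simp: list_all2_conv_all_nth nth_Cons' linear_coproduct linear_tid
          coproduct_in_tensor_power[simplified numeral_2_eq_2] tid_def[abs_def] pure_in_tensor_power)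
        (use linear_tid in \<open>simp add: tid_def[abs_def]\<close>)
    from tprod_tensor_maps[OF this]
    have "tprod (f # g # gs) (tensor_maps ?gs t) = tprod (convolution f g # gs) t" for t
      by (simp add: tids convolution_def[abs_def] concat_map_singleton[of "\<lambda>h. h", simplified])
    then have "tprod fs (coproduct_iter \<Delta> \<epsilon> (length fs) x) =
        tprod (convolution f g # gs) (coproduct_iter \<Delta> \<epsilon> (length (convolution f g # gs)) x)"
      using fs Cons by simp
    also have "\<dots> = convolution_list (convolution f g # gs) x"
      by (rule Suc.hyps(1)) (use l lin in \<open>auto intro: linear_convolution\<close>)
    also have "\<dots> = convolution_list fs x"
      using lin by (simp add: fs Cons convolution_assoc linear_convolution_list)
    finally show ?thesis .
  qed
qed

text \<open>The convolution form of the operator m \<circ> \<Delta>_D;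
  \<open>tmult_coproduct_comp\<close> identifies the two.\<close>

definition descent :: "nat list \<Rightarrow> 'h \<Rightarrow> 'h" where
  "descent D = convolution_list (map (hcomponent H) D)"

lemma descent_Nil [simp]: "descent [] = hcomponent H 0"
  and descent_Cons: "descent (d # D) = convolution (hcomponent H d) (descent D)"
  by (simp_all add: descent_def)

lemma linear_descent: "linear (descent D)"
  unfolding descent_def by (rule linear_convolution_list) (auto simp: linear_hcomponent)

lemma descent_append: "descent (D @ E) = convolution (descent D) (descent E)"
  unfolding descent_def by (simp add: convolution_list_append linear_hcomponent)

lemma tmult_coproduct_comp: "tmult (coproduct_comp H \<Delta> \<epsilon> D x) = descent D x"
proof -
  have "map (\<lambda>d. tid \<circ> hcomponent H d) D = map ((\<circ>) tid) (map (hcomponent H) D)" by simp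
  moreover have "\<forall>f\<in>set (map (hcomponent H) D). linear f" by (auto simp: linear_hcomponent)
  ultimately show ?thesis
    unfolding coproduct_comp_def descent_def
    using tmult_tensor_maps tprod_coproduct_iter[of "map (hcomponent H) D"]
    by (metis length_map)
qed

lemma descent_filter: "descent (filter (\<lambda>d. d \<noteq> 0) D) = descent D"
  by (induction D) (auto simp: descent_Cons convolution_unit_left linear_descent)

end

section \<open>Composition of descent operators\<close>

text \<open>The possible first rows of a matrix with column sums \<open>J\<close>. The same lists
  index the ways of distributing the parts of \<open>J\<close> over the two factors of a
  product.\<close>

definition lists_below :: "nat list \<Rightarrow> nat list set" where
  "lists_below J = {K. list_all2 (\<le>) K J}"

lemma lists_below_Nil: "lists_below [] = {[]}"
  by (auto simp: lists_below_def)

lemma lists_below_Cons: "lists_below (j # J) = (\<lambda>(i, K). i # K) ` ({..j} \<times> lists_below J)"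
  by (auto simp: lists_below_def list_all2_Cons2)

lemma finite_lists_below: "finite (lists_below J)"
  by (induction J) (simp_all add: lists_below_Nil lists_below_Cons)

lemma sum_lists_below_Cons:
  "(\<Sum>K\<in>lists_below (j # J). f K) = (\<Sum>i\<le>j. \<Sum>K\<in>lists_below J. f (i # K))"
  unfolding lists_below_Cons
  by (subst sum.reindex) (auto simp: inj_on_def sum.cartesian_product case_prod_unfold)

lemma margin_matrices_Nil: "margin_matrices [] J = (if sum_list J = 0 then {[]} else {})"
  by (auto simp: margin_matrices_def set_conv_nth)

text \<open>Removing the first row \<open>K\<close> leaves a matrix whose column sums are reduced by
  \<open>K\<close>. This recursion carries the induction in \<open>descent_descent\<close>.\<close>

lemma margin_matrices_Cons:
  "margin_matrices (i # I) J = (\<lambda>(K, M). K # M) `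
     (SIGMA K:{K \<in> lists_below J. sum_list K = i}. margin_matrices I (map2 (-) J K))"
proof -
  have eq: "K # M \<in> margin_matrices (i # I) J \<longleftrightarrow>
      K \<in> lists_below J \<and> sum_list K = i \<and> M \<in> margin_matrices I (map2 (-) J K)" for K M
  proof (cases "length K = length J")
    case True
    \<comment> \<open>Subtraction is truncated, so a column equation is equivalent to the equation
      for the lower rows only together with the bound on the top entry.\<close>
    have "k + s = j \<longleftrightarrow> k \<le> j \<and> s = j - k" for k s j :: nat by auto
    then show ?thesis using True
      by (auto simp: margin_matrices_def lists_below_def list_all2_conv_all_nth All_less_Suc2
          sum.lessThan_Suc_shift sum_list_sum_nth atLeast0LessThan simp del: sum.lessThan_Suc)
  qed (auto simp: margin_matrices_def lists_below_def list_all2_lengthD)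
  show ?thesis
  proof (intro equalityI subsetI)
    fix N assume N: "N \<in> margin_matrices (i # I) J"
    then obtain K M where "N = K # M" by (cases N) (auto simp: margin_matrices_def)
    then show "N \<in> (\<lambda>(K, M). K # M) `
     (SIGMA K:{K \<in> lists_below J. sum_list K = i}. margin_matrices I (map2 (-) J K))"
      using N eq by auto
  qed (use eq in auto)
qed

lemma finite_margin_matrices: "finite (margin_matrices I J)"
  by (induction I arbitrary: J)
    (auto simp: margin_matrices_Nil margin_matrices_Cons finite_lists_below intro!: finite_imageI finite_SigmaI)

text \<open>Zero parts do not affect descent operators, so for 0-1 lists the operators of
  \<open>K\<close> and of its complement depend only on the number of ones.\<close>

lemma filter_lists_below_ones:
  assumes "K \<in> lists_below (replicate n 1)"
  shows "filter (\<lambda>d. d \<noteq> 0) K = replicate (sum_list K) 1"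
    and "filter (\<lambda>d. d \<noteq> 0) (map2 (-) (replicate n 1) K) = replicate (n - sum_list K) 1"
proof -
  have "filter (\<lambda>d. d \<noteq> 0) K = replicate (sum_list K) 1 \<and> sum_list K \<le> n \<and>
      filter (\<lambda>d. d \<noteq> 0) (map2 (-) (replicate n 1) K) = replicate (n - sum_list K) 1"
    using assms
  proof (induction n arbitrary: K)
    case (Suc n)
    then obtain i K' where "K = i # K'" "i \<le> 1" "K' \<in> lists_below (replicate n 1)"
      by (auto simp: lists_below_Cons)
    then show ?case using Suc.IH[of K'] by (auto simp: le_Suc_eq Suc_diff_le)
  qed (simp add: lists_below_Nil)
  then show "filter (\<lambda>d. d \<noteq> 0) K = replicate (sum_list K) 1"
    "filter (\<lambda>d. d \<noteq> 0) (map2 (-) (replicate n 1) K) = replicate (n - sum_list K) 1" by auto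
qed

text \<open>The lists are indicator vectors of subsets of \<open>n\<close> positions; distinguishing
  the first entry gives Pascal's rule.\<close>

lemma card_lists_below_ones: "card {K \<in> lists_below (replicate n 1). sum_list K = k} = n choose k"
proof (induction n arbitrary: k)
  case 0
  have "{K \<in> lists_below (replicate 0 1). sum_list K = k} = (if k = 0 then {[]} else {})"
    by (auto simp: lists_below_Nil)
  then show ?case by simp
next
  case (Suc n)
  let ?S = "\<lambda>n k. {K \<in> lists_below (replicate n 1). sum_list K = k}"
  have fin: "finite (?S n k)" for n k using finite_lists_below by simp
  show ?case
  proof (cases k)
    case 0
    have "?S (Suc n) k = (#) 0 ` ?S n 0"
      unfolding 0 by (auto simp: lists_below_Cons image_iff le_Suc_eq)
    then have "card (?S (Suc n) k) = card (?S n 0)" by (simp only: card_image inj_on_Cons1)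
    then show ?thesis using Suc[of 0] 0 by (simp only: binomial_n_0)
  next
    case (Suc k')
    have "?S (Suc n) k = (#) 0 ` ?S n k \<union> (#) 1 ` ?S n k'"
      unfolding Suc by (auto simp: lists_below_Cons image_iff le_Suc_eq)
    moreover have "card ((#) 0 ` ?S n k \<union> (#) 1 ` ?S n k') = card (?S n k) + card (?S n k')"
      using fin by (subst card_Un_disjoint) (auto simp: card_image)
    ultimately show ?thesis using Suc.IH Suc by simp
  qed
qed

section \<open>Degrees of descent operators and linear maps applied to convolutions\<close>

context graded_connected_hopf_algebra
begin

text \<open>Reduces a claim about all values of a convolution to homogeneous pure tensors. With
  \<open>S\<close> a graded piece it gives the degree of the values, with \<open>S = {0}\<close> the
  vanishing in wrong degrees.\<close>

lemma convolution_mem: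
  assumes "linear f" "linear g" "subspace S" "x \<in> H m"
    and "\<And>a b i j. a \<in> H i \<Longrightarrow> b \<in> H j \<Longrightarrow> i + j = m \<Longrightarrow> f a * g b \<in> S"
  shows "convolution f g x \<in> S"
  unfolding convolution_def
  using coproduct_graded[OF assms(4)]
proof (rule span_induct)
  have "linear (tprod [f, g])" by (rule linear_tprod) (use assms in auto)
  then show "subspace {t. tprod [f, g] t \<in> S}"
    using linear_subspace_vimage[OF _ assms(3)] by (simp add: vimage_def)
  show "tprod [f, g] t \<in> S" if "t \<in> {pure [a, b] |a b i j. a \<in> H i \<and> b \<in> H j \<and> i + j = m}" for t
    using that assms by (auto simp: tprod_pure)
qed

text \<open>Moves an outer map inside a convolution, given its expansion on products of values of
  \<open>f\<close> and \<open>g\<close>. It is applied to \<open>\<phi> = descent J\<close>, with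
  the index set \<open>Z\<close> running over matrices split into first row and rest.\<close>

lemma convolution_compose:
  assumes "linear f" "linear g" "linear \<phi>" "\<And>z. z \<in> Z \<Longrightarrow> linear (f' z) \<and> linear (g' z)"
    and "\<And>a b. \<phi> (f a * g b) = (\<Sum>z\<in>Z. f' z a * g' z b)"
  shows "\<phi> (convolution f g x) = (\<Sum>z\<in>Z. convolution (f' z) (g' z) x)"
  unfolding convolution_def
proof (rule linear_eq_on_span[of "\<lambda>t. \<phi> (tprod [f, g] t)" "\<lambda>t. \<Sum>z\<in>Z. tprod [f' z, g' z] t" 
      "{pure xs | xs. length xs = 2}"])
  have "linear (tprod [f, g])" by (rule linear_tprod) (use assms in auto)
  then show "linear (\<lambda>t. \<phi> (tprod [f, g] t))"
    using linear_compose[OF _ assms(3)] by (simp add: o_def)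
  show "linear (\<lambda>t. \<Sum>z\<in>Z. tprod [f' z, g' z] t)"
    by (rule linear_compose_sum) (use assms(4) in \<open>auto intro!: linear_tprod\<close>)
  show "\<Delta> x \<in> span {pure xs | xs. length xs = 2}"
    using coproduct_in_tensor_power by (simp add: tensor_power_def)
  fix t :: "'h tensor" assume "t \<in> {pure xs | xs. length xs = 2}"
  then obtain a b where t: "t = pure [a, b]" by (auto simp: length_Suc_conv numeral_2_eq_2)
  show "\<phi> (tprod [f, g] t) = (\<Sum>z\<in>Z. tprod [f' z, g' z] t)"
    using assms by (auto simp: t tprod_pure intro!: sum.cong)
qed

text \<open>Each projection forces its factor into the prescribed degree, and degrees add under
  multiplication.\<close>

lemma descent_in_H: "descent D x \<in> H (sum_list D)"
proof -
  have "descent D x \<in> H (sum_list D)" if "x \<in> H m" for m x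
    using that
  proof (induction D arbitrary: x m)
    case (Cons d D)
    have IH: "descent D b \<in> H (sum_list D)" for b
    proof -
      have "descent D (\<Sum>m | hcomponent H m b \<noteq> 0. hcomponent H m b) \<in> H (sum_list D)"
        unfolding linear_sum[OF linear_descent]
        by (intro subspace_sum subspace_H Cons.IH[OF hcomponent_in_H])
      then show ?thesis by (simp add: sum_hcomponents)
    qed
    show ?case unfolding descent_Cons
      by (rule convolution_mem[OF linear_hcomponent linear_descent subspace_H Cons.prems])
        (simp add: mult_graded hcomponent_in_H IH)
  qed (simp add: hcomponent_in_H)
  then have "descent D (\<Sum>m | hcomponent H m x \<noteq> 0. hcomponent H m x) \<in> H (sum_list D)"
    unfolding linear_sum[OF linear_descent] by (intro subspace_sum subspace_H) (blast intro: hcomponent_in_H)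
  then show ?thesis by (simp add: sum_hcomponents)
qed

text \<open>The coproduct preserves total degree, so in each term of \<open>\<Delta> x\<close>
  either the first factor misses degree \<open>d\<close> or the second misses
  \<open>sum_list D\<close>.\<close>

lemma descent_eq_0:
  assumes "x \<in> H m" "m \<noteq> sum_list D"
  shows "descent D x = 0"
  using assms
proof (induction D arbitrary: x m)
  case Nil
  then show ?case by (simp add: hcomponent_homogeneous)
next
  case (Cons d D)
  have "descent (d # D) x \<in> {0}" unfolding descent_Cons
    by (rule convolution_mem[OF linear_hcomponent linear_descent _ Cons.prems(1)])
      (use Cons in \<open>auto simp: hcomponent_homogeneous\<close>)
  then show ?case by simp
qed

lemma descent_hcomponent: "descent D (hcomponent H i x) = (if sum_list D = i then descent D x else 0)"
proof (cases "sum_list D = i")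
  case True
  have "descent D (hcomponent H i x) = descent D x"
    by (rule linear_eq_on_graded[of "\<lambda>x. descent D (hcomponent H i x)" "descent D"])
      (use linear_compose[OF linear_hcomponent linear_descent] True in
        \<open>auto simp: o_def linear_descent hcomponent_homogeneous descent_eq_0 linear_0[OF linear_descent]\<close>)
  then show ?thesis using True by simp
next
  case False
  then show ?thesis using descent_eq_0[OF hcomponent_in_H] by auto
qed

text \<open>Both sides are bilinear, so \<open>a\<close> and \<open>b\<close> may be taken
  homogeneous; then only the summand with \<open>i\<close> equal to the degree of \<open>a\<close>
  can survive. Linearity is used first in \<open>b\<close>, then in \<open>a\<close>.\<close>

lemma hcomponent_mult:
  "hcomponent H d (a * b) = (\<Sum>i\<le>d. hcomponent H i a * hcomponent H (d - i) b)"
proof -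
  have "hcomponent H d (a * b) = (\<Sum>i\<le>d. hcomponent H i a * hcomponent H (d - i) b)"
    if "a \<in> H p" "b \<in> H q" for a b p q
  proof -
    have "hcomponent H i a * hcomponent H (d - i) b = (if i = p then if d = p + q then a * b else 0 else 0)"
      if "i \<le> d" for i
      using that \<open>a \<in> H p\<close> \<open>b \<in> H q\<close> by (auto simp: hcomponent_homogeneous)
    then show ?thesis using mult_graded[OF that] by (simp add: hcomponent_homogeneous)
  qed
  note gen = this
  have *: "hcomponent H d (a * b) = (\<Sum>i\<le>d. hcomponent H i a * hcomponent H (d - i) b)"
    if "a \<in> H p" for a b p
  proof (rule linear_eq_on_graded[of "\<lambda>b. hcomponent H d (a * b)"
        "\<lambda>b. \<Sum>i\<le>d. hcomponent H i a * hcomponent H (d - i) b"])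
    show "linear (\<lambda>b. hcomponent H d (a * b))"
      by (rule linearI) (simp_all add: algebra_simps linear_add[OF linear_hcomponent] linear_scale[OF linear_hcomponent])
    show "linear (\<lambda>b. \<Sum>i\<le>d. hcomponent H i a * hcomponent H (d - i) b)"
      by (rule linearI) (simp_all add: algebra_simps linear_add[OF linear_hcomponent] linear_scale[OF linear_hcomponent]
        sum.distrib scaleR_sum_right)
  qed (use that gen in blast)
  show ?thesis
  proof (rule linear_eq_on_graded[of "\<lambda>a. hcomponent H d (a * b)"
        "\<lambda>a. \<Sum>i\<le>d. hcomponent H i a * hcomponent H (d - i) b"])
    show "linear (\<lambda>a. hcomponent H d (a * b))"
      by (rule linearI) (simp_all add: algebra_simps linear_add[OF linear_hcomponent] linear_scale[OF linear_hcomponent])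
    show "linear (\<lambda>a. \<Sum>i\<le>d. hcomponent H i a * hcomponent H (d - i) b)"
      by (rule linearI) (simp_all add: algebra_simps linear_add[OF linear_hcomponent] linear_scale[OF linear_hcomponent]
        sum.distrib scaleR_sum_right)
  qed (use * in blast)
qed

end

section \<open>Product rule and composition rule for descent operators in the commutative
  case\<close>

locale commutative_graded_hopf_algebra = graded_connected_hopf_algebra +
  assumes mult_commutes: "\<And>a b :: 'a. a * b = b * a"
begin

text \<open>Multiplicativity of the coproduct transfers product rules for \<open>f\<close> and
  \<open>g\<close> to their convolution. Commutativity enters when the two middle factors, one from
  \<open>a\<close> and one from \<open>b\<close>, are exchanged.\<close>

lemma convolution_mult:
  assumes f: "linear f" "\<And>k. linear (f' k)" "\<And>k. linear (f'' k)"
    and g: "linear g" "\<And>l. linear (g' l)" "\<And>l. linear (g'' l)"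
    and fab: "\<And>a b. f (a * b) = (\<Sum>k\<in>K. f' k a * f'' k b)"
    and gab: "\<And>a b. g (a * b) = (\<Sum>l\<in>L. g' l a * g'' l b)"
  shows "convolution f g (a * b) =
    (\<Sum>k\<in>K. \<Sum>l\<in>L. convolution (f' k) (g' l) a * convolution (f'' k) (g'' l) b)"
proof -
  have lin: "linear (tprod [f, g])" "linear (tprod [f' k, g' l])" "linear (tprod [f'' k, g'' l])" for k l
    by (rule linear_tprod, use f g in auto)+
  have L: "bilinear (\<lambda>s t. tprod [f, g] (tensor_times s t))"
    by (rule bilinear_compose_linear[OF bilinear_tensor_times lin(1)])
  have R: "bilinear (\<lambda>s t. \<Sum>k\<in>K. \<Sum>l\<in>L. tprod [f' k, g' l] s * tprod [f'' k, g'' l] t)"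
    using bilinear_mult_linear[OF lin(2,3)] unfolding bilinear_def
    by (intro conjI allI linear_compose_sum ballI) blast+
  have "tprod [f, g] (tensor_times s t) =
      (\<Sum>k\<in>K. \<Sum>l\<in>L. tprod [f' k, g' l] s * tprod [f'' k, g'' l] t)"
    if s: "s \<in> {pure xs |xs. length xs = 2}" and t: "t \<in> {pure xs |xs. length xs = 2}" for s t
  proof -
    from s obtain a1 a2 where s: "s = pure [a1, a2]" by (auto simp: length_Suc_conv numeral_2_eq_2)
    from t obtain b1 b2 where t: "t = pure [b1, b2]" by (auto simp: length_Suc_conv numeral_2_eq_2)
    have "tprod [f, g] (tensor_times s t) = f (a1 * b1) * g (a2 * b2)"
      using f g by (simp add: s t tensor_times_pure tprod_pure)
    also have "\<dots> = (\<Sum>k\<in>K. \<Sum>l\<in>L. (f' k a1 * f'' k b1) * (g' l a2 * g'' l b2))"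
      by (simp add: fab gab sum_product)
    also have "\<dots> = (\<Sum>k\<in>K. \<Sum>l\<in>L. tprod [f' k, g' l] s * tprod [f'' k, g'' l] t)"
    proof (intro sum.cong refl)
      fix k l
      have "(f' k a1 * f'' k b1) * (g' l a2 * g'' l b2) = f' k a1 * (f'' k b1 * g' l a2) * g'' l b2"
        by (simp add: mult.assoc)
      also have "f'' k b1 * g' l a2 = g' l a2 * f'' k b1" by (rule mult_commutes)
      finally show "(f' k a1 * f'' k b1) * (g' l a2 * g'' l b2) = tprod [f' k, g' l] s * tprod [f'' k, g'' l] t"
        using f g by (simp add: s t tprod_pure mult.assoc)
    qed
    finally show ?thesis .
  qed
  then show ?thesis
    unfolding convolution_def coproduct_mult
    using coproduct_in_tensor_power unfolding tensor_power_def
    by (intro bilinear_eq[OF L R order_refl order_refl, of "\<Delta> a" _ "\<Delta> b"])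
qed

text \<open>Induction on \<open>J\<close>: \<open>hcomponent_mult\<close> treats one part and
  \<open>convolution_mult\<close> joins it to the rest. The entries of \<open>K\<close> are the
  degrees taken from \<open>a\<close>.\<close>

lemma descent_mult:
  "descent J (a * b) = (\<Sum>K\<in>lists_below J. descent K a * descent (map2 (-) J K) b)"
proof (induction J arbitrary: a b)
  case Nil
  then show ?case by (simp add: lists_below_Nil hcomponent_mult)
next
  case (Cons j J)
  have "descent (j # J) (a * b) = (\<Sum>i\<le>j. \<Sum>K\<in>lists_below J.
      convolution (hcomponent H i) (descent K) a * convolution (hcomponent H (j - i)) (descent (map2 (-) J K)) b)"
    unfolding descent_Cons
    by (rule convolution_mult) (rule linear_hcomponent linear_descent hcomponent_mult Cons.IH)+
  then show ?case by (simp add: sum_lists_below_Cons descent_Cons)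
qed

text \<open>Induction on the row sums \<open>I\<close>. By the product rule \<open>descent J\<close>
  distributes over the first factor, of degree \<open>i\<close>, and the remaining factors; the
  first share is the top row \<open>K\<close>, and the induction hypothesis expands the other share
  over matrices with the reduced column sums.\<close>

lemma descent_descent:
  "descent J (descent I x) = (\<Sum>M\<in>margin_matrices I J. descent (concat M) x)"
proof (induction I arbitrary: J x)
  case Nil
  \<comment> \<open>Without rows all column sums are 0, but \<open>J\<close> may still be a nonempty
    list of zeros; it acts like the empty list.\<close>
  have "descent J = hcomponent H 0" if "sum_list J = 0"
  proof -
    have "filter (\<lambda>d. d \<noteq> 0) J = []" using that by (auto simp: filter_empty_conv)
    then show ?thesis using descent_filter[of J] by simp
  qed
  then show ?case by (simp add: margin_matrices_Nil descent_hcomponent del: sum_list_eq_0_iff)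
next
  case (Cons i I)
  let ?K = "{K \<in> lists_below J. sum_list K = i}"
  let ?Z = "SIGMA K:?K. margin_matrices I (map2 (-) J K)"
  have prod: "descent J (hcomponent H i a * descent I b) =
      (\<Sum>(K, M)\<in>?Z. descent K a * descent (concat M) b)" for a b
  proof -
    \<comment> \<open>The condition on the row sum arises because \<open>descent K\<close> kills the
      component of degree \<open>i\<close> unless the entries of \<open>K\<close> add up to
      \<open>i\<close>.\<close>
    have "descent J (hcomponent H i a * descent I b) = (\<Sum>K\<in>lists_below J.
        if sum_list K = i then descent K a * descent (map2 (-) J K) (descent I b) else 0)"
      unfolding descent_mult by (intro sum.cong refl) (simp add: descent_hcomponent)
    also have "\<dots> = (\<Sum>K\<in>?K. \<Sum>M\<in>margin_matrices I (map2 (-) J K). descent K a * descent (concat M) b)"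
      by (simp add: Cons.IH sum_distrib_left sum.inter_filter finite_lists_below cong: if_cong)
    also have "\<dots> = (\<Sum>(K, M)\<in>?Z. descent K a * descent (concat M) b)"
      by (rule sum.Sigma) (simp_all add: finite_lists_below finite_margin_matrices)
    finally show ?thesis .
  qed
  have "descent J (descent (i # I) x) = (\<Sum>z\<in>?Z. convolution (descent (fst z)) (descent (concat (snd z))) x)"
    unfolding descent_Cons
    by (rule convolution_compose)
      (use prod in \<open>simp_all add: linear_hcomponent linear_descent case_prod_unfold\<close>)
  also have "\<dots> = (\<Sum>M\<in>margin_matrices (i # I) J. descent (concat M) x)"
    unfolding margin_matrices_Cons
    by (subst sum.reindex) (auto simp: inj_on_def case_prod_unfold descent_append)
  finally show ?case .
qed

text \<open>In the product rule, \<open>descent K a\<close> vanishes for degree reasons unless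
  \<open>K\<close> contains exactly one 1, in which case it returns \<open>a\<close>. The
  \<open>n\<close> positions of this 1 contribute equal terms.\<close>

lemma descent_ones_mult:
  assumes a: "a \<in> H 1"
  shows "descent (replicate n 1) (a * b) = real n *\<^sub>R (a * descent (replicate (n - 1) 1) b)"
proof -
  let ?S = "{K \<in> lists_below (replicate n 1). sum_list K = 1}"
  have "descent (replicate n 1) (a * b) =
      (\<Sum>K\<in>lists_below (replicate n 1). if sum_list K = 1 then a * descent (replicate (n - 1) 1) b else 0)"
    unfolding descent_mult
  proof (intro sum.cong refl)
    fix K assume K: "K \<in> lists_below (replicate n 1)"
    have "descent K a = (if sum_list K = 1 then a else 0)"
    proof (cases "sum_list K = 1")
      case True
      then have "descent K = hcomponent H 1"
        using descent_filter[of K] filter_lists_below_ones(1)[OF K]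
        by (simp add: descent_Cons convolution_unit_right linear_hcomponent)
      then show ?thesis using a True by (simp add: hcomponent_homogeneous)
    qed (use descent_eq_0[OF a, of K] in auto)
    moreover have "descent (map2 (-) (replicate n 1) K) = descent (replicate (n - sum_list K) 1)"
      using descent_filter[of "map2 (-) (replicate n 1) K"] filter_lists_below_ones(2)[OF K] by simp
    ultimately show "descent K a * descent (map2 (-) (replicate n 1) K) b =
        (if sum_list K = 1 then a * descent (replicate (n - 1) 1) b else 0)" by simp
  qed
  also have "\<dots> = (\<Sum>K\<in>?S. a * descent (replicate (n - 1) 1) b)"
    by (rule sum.inter_filter[symmetric], rule finite_lists_below)
  also have "\<dots> = real (card ?S) *\<^sub>R (a * descent (replicate (n - 1) 1) b)"
    by (rule sum_constant_scaleR)
  finally show ?thesis using card_lists_below_ones[of n 1] by simp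
qed

text \<open>Peeling off the factors one by one contributes the number of ones still present, hence
  the factorial.\<close>

lemma descent_ones_prod_list:
  "set as \<subseteq> H 1 \<Longrightarrow> descent (replicate (length as) 1) (prod_list as) = fact (length as) *\<^sub>R prod_list as"
proof (induction as)
  case Nil
  then show ?case using one_in_H0 by (simp add: hcomponent_homogeneous)
next
  case (Cons a as)
  then show ?case using descent_ones_mult[of a "Suc (length as)" "prod_list as"] by simp
qed

end

section \<open>Monomial quasisymmetric functions\<close>

lemma lookup_sum_single:
  fixes D :: "nat list"
  shows "Poly_Mapping.lookup (\<Sum>k<length D. Poly_Mapping.single (is ! k) (D ! k)) j =
    (\<Sum>k<length D. if is ! k = j then D ! k else 0)"
  by (auto simp: lookup_sum lookup_single when_def intro!: sum.cong)

text \<open>The monomial using the first \<open>length E\<close> variables with exponents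
  \<open>E\<close> acts as a test for \<open>E\<close>: since parts are nonzero, its support and
  exponents determine the composition. Its coefficient is thus a functional dual to the monomial
  functions.\<close>

lemma monomial_qsym_packed:
  assumes "0 \<notin> set D" "0 \<notin> set E"
  shows "monomial_qsym D (\<Sum>k<length E. Poly_Mapping.single k (E ! k)) = (if D = E then 1 else 0)"
proof (cases "D = E")
  case True
  have eq: "(\<Sum>k<length E. Poly_Mapping.single k (E ! k)) =
      (\<Sum>k<length E. Poly_Mapping.single ([0..<length E] ! k) (E ! k))"
    by (intro sum.cong) auto
  have "\<exists>is. length is = length E \<and> sorted_wrt (<) is \<and>
      (\<Sum>k<length E. Poly_Mapping.single k (E ! k)) = (\<Sum>k<length E. Poly_Mapping.single (is ! k) (E ! k))"
    by (intro exI[of _ "[0..<length E]"] conjI eq) simp_all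
  then show ?thesis unfolding True monomial_qsym_def by (simp only: if_True simp_thms)
next
  case False
  have no: False if "is": "length is = length D" "sorted_wrt (<) is"
    "(\<Sum>k<length E. Poly_Mapping.single k (E ! k)) = (\<Sum>k<length D. Poly_Mapping.single (is ! k) (D ! k))" for "is"
  proof -
    have dist: "distinct is" using "is"(2) by (simp add: strict_sorted_iff)
    \<comment> \<open>\<open>l\<close> is the exponent vector, to be read off both from
      \<open>E\<close> (fact \<open>L\<close>) and from \<open>D\<close> along the indices
      \<open>is\<close> (facts \<open>R\<close> and \<open>R0\<close>).\<close>
    define l where "l j = Poly_Mapping.lookup (\<Sum>k<length E. Poly_Mapping.single k (E ! k)) j" for j
    have L: "l j = (if j < length E then E ! j else 0)" for j
      by (simp add: l_def lookup_sum lookup_single when_def)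
    have sum: "l j = (\<Sum>k<length D. if is ! k = j then D ! k else 0)" for j
      unfolding l_def "is"(3) by (rule lookup_sum_single)
    have R: "l (is ! k) = D ! k" if "k < length D" for k
    proof -
      have "l (is ! k) = (\<Sum>l<length D. if l = k then D ! l else 0)"
        unfolding sum using that dist "is"(1) by (intro sum.cong) (auto simp: nth_eq_iff_index_eq)
      then show ?thesis using that by simp
    qed
    have R0: "l j = 0" if "j \<notin> set is" for j
      unfolding sum using that "is"(1) by (intro sum.neutral) auto
    \<comment> \<open>As no part is 0, both sides describe the support of the exponent vector; a
      strictly increasing list is then determined by it.\<close>
    have mem: "j \<in> set is \<longleftrightarrow> j < length E" for j
    proof
      assume "j \<in> set is"
      then obtain k where k: "k < length D" "j = is ! k" using "is"(1) by (auto simp: in_set_conv_nth)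
      have "D ! k \<in> set D" using k by simp
      then have "D ! k \<noteq> 0" using assms(1) by metis
      then have "l j \<noteq> 0" using R[OF k(1)] k(2) by simp
      then show "j < length E" using L[of j] by (auto split: if_splits)
    next
      assume j: "j < length E"
      then have "E ! j \<in> set E" by simp
      then have "E ! j \<noteq> 0" using assms(2) by metis
      then have "l j \<noteq> 0" using L[of j] j by simp
      then show "j \<in> set is" using R0[of j] by fastforce
    qed
    have set: "set is = set [0..<length E]"
      by (rule set_eqI) (simp only: mem set_upt atLeastLessThan_iff zero_le simp_thms)
    have "sorted is" using "is"(2) by (simp add: strict_sorted_iff)
    then have *: "is = [0..<length E]"
      by (rule sorted_distinct_set_unique[OF _ dist sorted_upt distinct_upt set])
    then have len: "length D = length E" using "is"(1) by simp
    have "D = E"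
    proof (rule nth_equalityI[OF len])
      fix k assume k: "k < length D"
      then have "is ! k = k" using * len by simp
      then show "D ! k = E ! k" using R[OF k] L[of k] k len by simp
    qed
    then show False using False by simp
  qed
  have "\<not> (\<exists>is. length is = length D \<and> sorted_wrt (<) is \<and>
      (\<Sum>k<length E. Poly_Mapping.single k (E ! k)) = (\<Sum>k<length D. Poly_Mapping.single (is ! k) (D ! k)))"
    by (rule notI, elim exE conjE) (rule no)
  then show ?thesis unfolding monomial_qsym_def by (simp only: False if_False)
qed

text \<open>\<open>qsym_coords\<close> is a definite description, so uniqueness has to be shown: the
  coefficient of the packed monomial of \<open>E\<close> recovers the coordinate at \<open>E\<close>
  from any expansion.\<close>

lemma lookup_qsym_coords:
  assumes K: "finite K" "\<And>D. D \<in> K \<Longrightarrow> 0 \<notin> set D"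
  shows "Poly_Mapping.lookup (qsym_coords (\<lambda>\<alpha>. \<Sum>D\<in>K. c D * monomial_qsym D \<alpha>)) E = (if E \<in> K then c E else 0)"
proof -
  define p where "p = (\<Sum>D\<in>K. Poly_Mapping.single D (c D))"
  have p: "Poly_Mapping.lookup p E = (if E \<in> K then c E else 0)" for E
    using K(1) by (simp add: p_def lookup_sum lookup_single when_def)
  have keys: "Poly_Mapping.keys p \<subseteq> K" by (auto simp: in_keys_iff p split: if_splits)
  have "qsym_coords (\<lambda>\<alpha>. \<Sum>D\<in>K. c D * monomial_qsym D \<alpha>) = p"
    unfolding qsym_coords_def
  proof (rule the_equality)
    have "(\<Sum>D\<in>Poly_Mapping.keys p. Poly_Mapping.lookup p D * monomial_qsym D \<alpha>) =
        (\<Sum>D\<in>K. c D * monomial_qsym D \<alpha>)" for \<alpha>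
      using K(1) keys p by (intro sum.mono_neutral_cong_left) (auto simp: in_keys_iff)
    then show "(\<forall>D\<in>Poly_Mapping.keys p. 0 \<notin> set D) \<and> (\<lambda>\<alpha>. \<Sum>D\<in>K. c D * monomial_qsym D \<alpha>) =
        (\<lambda>\<alpha>. \<Sum>D\<in>Poly_Mapping.keys p. Poly_Mapping.lookup p D * monomial_qsym D \<alpha>)"
      using K keys by auto
  next
    fix q assume q: "(\<forall>D\<in>Poly_Mapping.keys q. 0 \<notin> set D) \<and> (\<lambda>\<alpha>. \<Sum>D\<in>K. c D * monomial_qsym D \<alpha>) =
        (\<lambda>\<alpha>. \<Sum>D\<in>Poly_Mapping.keys q. Poly_Mapping.lookup q D * monomial_qsym D \<alpha>)"
    show "q = p"
    proof (rule poly_mapping_eqI)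
      fix E
      show "Poly_Mapping.lookup q E = Poly_Mapping.lookup p E"
      proof (cases "0 \<in> set E")
        case True
        then have "E \<notin> K" "E \<notin> Poly_Mapping.keys q" using K q by auto
        then show ?thesis by (simp add: p in_keys_iff)
      next
        case False
        let ?\<alpha> = "\<Sum>k<length E. Poly_Mapping.single k (E ! k)"
        have "(\<Sum>D\<in>K. c D * monomial_qsym D ?\<alpha>) = (\<Sum>D\<in>K. if D = E then c E else 0)"
          using K False by (intro sum.cong) (auto simp: monomial_qsym_packed)
        also have "\<dots> = Poly_Mapping.lookup p E" using K by (simp add: p)
        finally have 1: "(\<Sum>D\<in>K. c D * monomial_qsym D ?\<alpha>) = Poly_Mapping.lookup p E" .
        have "(\<Sum>D\<in>Poly_Mapping.keys q. Poly_Mapping.lookup q D * monomial_qsym D ?\<alpha>) =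
            (\<Sum>D\<in>Poly_Mapping.keys q. if D = E then Poly_Mapping.lookup q E else 0)"
          using q False by (intro sum.cong) (auto simp: monomial_qsym_packed)
        also have "\<dots> = Poly_Mapping.lookup q E" by (simp add: in_keys_iff)
        finally show ?thesis using 1 fun_cong[OF conjunct2[OF q], of ?\<alpha>] by simp
      qed
    qed
  qed
  then show ?thesis by (simp add: p)
qed

section \<open>Finite Markov chains\<close>

text \<open>The Markov property conditions on the entire past, so the event at time
  \<open>Suc t\<close> is split over all histories up to \<open>t\<close> and the histories are then
  regrouped by their last state.\<close>

lemma markov_chain_step:
  assumes mc: "markov_chain M X S K x\<^sub>0" and S: "finite S" and y: "y \<in> S"
  shows "\<P>(\<omega> in M. X (Suc t) \<omega> = y) = (\<Sum>w\<in>S. \<P>(\<omega> in M. X t \<omega> = w) * K w y)"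
proof -
  interpret prob_space M using mc by (simp add: markov_chain_def)
  have X: "X s \<in> measurable M (count_space S)" for s using mc by (simp add: markov_chain_def)
  have XS: "X s \<omega> \<in> S" if "\<omega> \<in> space M" for s \<omega>
    using measurable_space[OF X that] by simp
  have ev: "{\<omega> \<in> space M. X s \<omega> = w} \<in> sets M" if "w \<in> S" for s w
    using measurable_sets[OF X, of "{w}" s] that by (simp add: vimage_def Int_def conj_commute)
  \<comment> \<open>Histories are taken extensional on \<open>{..t}\<close>, so there are finitely
    many and different ones give disjoint events.\<close>
  define Z where "Z = PiE {..t} (\<lambda>_. S)"
  have finZ: "finite Z" unfolding Z_def using S by (intro finite_PiE) auto
  define hist where "hist z = {\<omega> \<in> space M. \<forall>s\<le>t. X s \<omega> = z s}" for z
  have hist: "hist z \<in> sets M" if "z \<in> Z" for z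
  proof -
    have "hist z = (\<Inter>s\<in>{..t}. {\<omega> \<in> space M. X s \<omega> = z s})" unfolding hist_def by auto
    then show ?thesis using that ev by (auto simp: Z_def PiE_iff intro!: sets.finite_INT)
  qed
  have part: "prob C = (\<Sum>z\<in>Z. prob (hist z \<inter> C))" if C: "C \<in> sets M" for C
  proof -
    have "(\<Union>z\<in>Z. hist z \<inter> C) = C"
    proof (intro equalityI subsetI)
      fix \<omega> assume \<omega>: "\<omega> \<in> C"
      then have sp: "\<omega> \<in> space M" using sets.sets_into_space[OF C] by auto
      have "(\<lambda>s\<in>{..t}. X s \<omega>) \<in> Z" using XS[OF sp] by (auto simp: Z_def)
      moreover have "\<omega> \<in> hist (\<lambda>s\<in>{..t}. X s \<omega>)" using sp by (auto simp: hist_def)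
      ultimately show "\<omega> \<in> (\<Union>z\<in>Z. hist z \<inter> C)" using \<omega> by blast
    qed auto
    moreover have "disjoint_family_on (\<lambda>z. hist z \<inter> C) Z"
      unfolding disjoint_family_on_def
    proof (intro ballI impI)
      fix z z' assume zz: "z \<in> Z" "z' \<in> Z" "z \<noteq> z'"
      have "hist z \<inter> hist z' = {}"
      proof (rule ccontr)
        assume "hist z \<inter> hist z' \<noteq> {}"
        then have "z s = z' s" if "s \<le> t" for s using that by (auto simp: hist_def)
        then have "z = z'" using zz unfolding Z_def by (intro PiE_ext) auto
        then show False using zz by simp
      qed
      then show "(hist z \<inter> C) \<inter> (hist z' \<inter> C) = {}" by blast
    qed
    ultimately show ?thesis
      using finite_measure_finite_Union[OF finZ, of "\<lambda>z. hist z \<inter> C"] hist C by auto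
  qed
  \<comment> \<open>Transition probabilities are prescribed only after histories of positive
    probability; for null histories both sides are 0.\<close>
  have cond: "prob (hist z \<inter> {\<omega> \<in> space M. X (Suc t) \<omega> = y}) = prob (hist z) * K (z t) y" if "z \<in> Z" for z
  proof (cases "prob (hist z) > 0")
    case True
    then have "\<P>(\<omega> in M. X (Suc t) \<omega> = y \<bar> \<forall>s\<le>t. X s \<omega> = z s) = K (z t) y"
      using mc y unfolding markov_chain_def hist_def by blast
    moreover have "{\<omega> \<in> space M. X (Suc t) \<omega> = y \<and> (\<forall>s\<le>t. X s \<omega> = z s)} =
        hist z \<inter> {\<omega> \<in> space M. X (Suc t) \<omega> = y}" by (auto simp: hist_def)
    ultimately show ?thesis using True by (simp add: cond_prob_def flip: hist_def) (simp add: field_simps)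
  next
    case False
    then have "prob (hist z) = 0" using measure_nonneg[of M "hist z"] by linarith
    moreover have "prob (hist z \<inter> {\<omega> \<in> space M. X (Suc t) \<omega> = y}) \<le> prob (hist z)"
      using hist[OF that] by (intro finite_measure_mono) auto
    ultimately show ?thesis using measure_nonneg[of M] by (simp add: order_antisym)
  qed
  have now: "prob {\<omega> \<in> space M. X t \<omega> = w} = (\<Sum>z\<in>Z. if z t = w then prob (hist z) else 0)" if "w \<in> S" for w
  proof -
    have "hist z \<inter> {\<omega> \<in> space M. X t \<omega> = w} = (if z t = w then hist z else {})" for z
      by (auto simp: hist_def)
    then show ?thesis unfolding part[OF ev[OF that]] by (intro sum.cong) auto
  qed
  have "(\<Sum>w\<in>S. prob {\<omega> \<in> space M. X t \<omega> = w} * K w y) =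
      (\<Sum>w\<in>S. \<Sum>z\<in>Z. if z t = w then prob (hist z) * K (z t) y else 0)"
    by (intro sum.cong refl) (auto simp: now sum_distrib_right intro!: sum.cong)
  also have "\<dots> = (\<Sum>z\<in>Z. \<Sum>w\<in>S. if z t = w then prob (hist z) * K (z t) y else 0)"
    by (rule sum.swap)
  also have "\<dots> = (\<Sum>z\<in>Z. prob (hist z) * K (z t) y)"
    using S by (intro sum.cong refl) (auto simp: Z_def PiE_iff)
  also have "\<dots> = prob {\<omega> \<in> space M. X (Suc t) \<omega> = y}"
    unfolding part[OF ev[OF y]] using cond by (intro sum.cong) auto
  finally show ?thesis by simp
qed

section \<open>The action of noncommutative symmetric functions\<close>

lemma finite_compositions: "finite (compositions n)"
proof (rule finite_subset)
  have "length D \<le> sum_list D" if "0 \<notin> set D" for D :: "nat list"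
    using that by (induction D) auto
  then show "compositions n \<subseteq> {D. set D \<subseteq> {..n} \<and> length D \<le> n}"
    using member_le_sum_list by (fastforce simp: compositions_def)
qed (simp add: finite_lists_length_le)

text \<open>The type \<open>nsym\<close> also admits words with zero parts. Such words have zero
  coordinate in every function \<open>chi\<close> although their descent operators need not vanish,
  so they must be excluded before pairing.\<close>

definition strict_nsym :: "nsym set" where
  "strict_nsym = {a. \<forall>E\<in>Poly_Mapping.keys a. 0 \<notin> set E}"

lemma subspace_strict_nsym: "subspace strict_nsym"
  unfolding subspace_def strict_nsym_def
  using keys_add by (auto simp: in_keys_iff lookup_scaleR lookup_add)

lemma complete_nsym_strict: "complete_nsym D \<in> strict_nsym"
  by (simp add: complete_nsym_def strict_nsym_def)

lemma internal_product_strict: "internal_product a b \<in> strict_nsym"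
  unfolding internal_product_def
  by (intro subspace_sum subspace_scale subspace_strict_nsym complete_nsym_strict)

lemma distribution_nsym_strict: "distribution_nsym n P \<in> strict_nsym"
  unfolding distribution_nsym_def
  by (intro subspace_sum subspace_scale subspace_strict_nsym complete_nsym_strict)

text \<open>\<open>t\<close> counts factors, and the definition iterates \<open>t - 1\<close> times
  starting from \<open>a\<close>. Truncation makes the power 0 equal to \<open>a\<close> as well,
  hence the condition \<open>t \<ge> 1\<close>.\<close>

lemma internal_power_Suc: "t \<ge> 1 \<Longrightarrow> internal_power a (Suc t) = internal_product (internal_power a t) a"
  by (cases t) (simp_all add: internal_power_def)

lemma internal_power_one: "internal_power a (Suc 0) = a"
  by (simp add: internal_power_def)

lemma internal_power_strict: "a \<in> strict_nsym \<Longrightarrow> internal_power a t \<in> strict_nsym"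
  by (cases "t - 1") (simp_all add: internal_power_def internal_product_strict)

context graded_connected_hopf_algebra
begin

text \<open>The word S^D acts as m \<circ> \<Delta>_D. For the internal product this is a right
  action in the commutative case: the left factor is applied first.\<close>

definition nsym_action :: "nsym \<Rightarrow> 'h \<Rightarrow> 'h" where
  "nsym_action a x = (\<Sum>E\<in>Poly_Mapping.keys a. Poly_Mapping.lookup a E *\<^sub>R descent E x)"

lemma linear_nsym_action: "linear (nsym_action a)"
  unfolding nsym_action_def[abs_def]
  by (intro linear_compose_sum ballI linear_compose_scale_right linear_descent)

lemma linear_nsym_action_left: "linear (\<lambda>a. nsym_action a x)"
proof (rule linearI)
  have sup: "nsym_action a x = (\<Sum>E\<in>A. Poly_Mapping.lookup a E *\<^sub>R descent E x)"
    if "finite A" "Poly_Mapping.keys a \<subseteq> A" for a A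
    unfolding nsym_action_def using that by (intro sum.mono_neutral_left) (auto simp: in_keys_iff)
  fix a b :: nsym and c :: real
  have "Poly_Mapping.keys (a + b) \<subseteq> Poly_Mapping.keys a \<union> Poly_Mapping.keys b" by (rule keys_add)
  then show "nsym_action (a + b) x = nsym_action a x + nsym_action b x"
    by (simp add: sup[of "Poly_Mapping.keys a \<union> Poly_Mapping.keys b"] lookup_add scaleR_left_distrib sum.distrib)
  have "Poly_Mapping.keys (c *\<^sub>R a) \<subseteq> Poly_Mapping.keys a" by (auto simp: in_keys_iff lookup_scaleR)
  then show "nsym_action (c *\<^sub>R a) x = c *\<^sub>R nsym_action a x"
    by (simp add: sup[of "Poly_Mapping.keys a"] lookup_scaleR scaleR_sum_right)
qed

lemma nsym_action_complete: "nsym_action (complete_nsym D) x = descent D x"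
  by (simp add: nsym_action_def complete_nsym_def descent_filter del: neq0_conv)

end

context commutative_graded_hopf_algebra
begin

text \<open>The matrices in the internal product are exactly those that expand a composition of
  descent operators, so this is \<open>descent_descent\<close> extended bilinearly.\<close>

lemma nsym_action_internal_product:
  "nsym_action (internal_product a b) x = nsym_action b (nsym_action a x)"
proof -
  note lin = linear_nsym_action_left[of x]
  have "nsym_action (internal_product a b) x = (\<Sum>I\<in>Poly_Mapping.keys a. \<Sum>J\<in>Poly_Mapping.keys b.
      (Poly_Mapping.lookup a I * Poly_Mapping.lookup b J) *\<^sub>R descent J (descent I x))"
    unfolding internal_product_def
    by (simp add: linear_sum[OF lin] linear_scale[OF lin] nsym_action_complete descent_descent)
  also have "\<dots> = (\<Sum>J\<in>Poly_Mapping.keys b. \<Sum>I\<in>Poly_Mapping.keys a.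
      (Poly_Mapping.lookup a I * Poly_Mapping.lookup b J) *\<^sub>R descent J (descent I x))"
    by (rule sum.swap)
  also have "\<dots> = nsym_action b (nsym_action a x)"
    by (simp add: nsym_action_def linear_sum[OF linear_descent] linear_scale[OF linear_descent]
        scaleR_sum_right mult.commute)
  finally show ?thesis .
qed

lemma nsym_action_internal_power:
  "t \<ge> 1 \<Longrightarrow> nsym_action (internal_power a t) x = (nsym_action a ^^ t) x"
proof (induction t rule: dec_induct)
  case base
  then show ?case by (simp add: internal_power_one)
next
  case (step t)
  then show ?case by (simp add: internal_power_Suc nsym_action_internal_product)
qed

end

section \<open>Monomial bases\<close>

text \<open>Applying the functional dual to \<open>b\<close> to a linear relation isolates the
  coefficient of \<open>b\<close>. Used for the monomials and for the tensor bases.\<close>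

lemma independent_dualI:
  assumes "\<And>b. b \<in> B \<Longrightarrow> \<exists>f :: 'a::real_vector \<Rightarrow> real. linear f \<and> f b = 1 \<and> (\<forall>b'\<in>B. b' \<noteq> b \<longrightarrow> f b' = 0)"
  shows "independent B"
  unfolding independent_explicit_module
proof (intro allI impI)
  fix t u v assume t: "finite t" "t \<subseteq> B" "(\<Sum>v\<in>t. u v *\<^sub>R v) = 0" "v \<in> t"
  then obtain f :: "'a \<Rightarrow> real" where f: "linear f" "f v = 1" "\<forall>b'\<in>B. b' \<noteq> v \<longrightarrow> f b' = 0"
    using assms by blast
  have "0 = f (\<Sum>v\<in>t. u v *\<^sub>R v)" using t(3) linear_0[OF f(1)] by simp
  also have "\<dots> = (\<Sum>w\<in>t. u w * f w)" by (simp add: linear_sum[OF f(1)] linear_scale[OF f(1)])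
  also have "\<dots> = (\<Sum>w\<in>t. if w = v then u v else 0)"
    using f t(2) by (intro sum.cong) auto
  finally show "u v = 0" using t by simp
qed

lemma linear_eq_sum_representation:
  fixes f :: "'a::real_vector \<Rightarrow> real"
  assumes "independent C" "finite C" "v \<in> span C" "linear f"
  shows "f v = (\<Sum>c\<in>C. representation C v c * f c)"
proof -
  have "f v = f (\<Sum>c\<in>C. representation C v c *\<^sub>R c)"
    using sum_representation_eq[OF assms(1,3,2) order_refl] by simp
  then show ?thesis by (simp add: linear_sum[OF assms(4)] linear_scale[OF assms(4)])
qed

text \<open>Entries are replaced by elements of the spanning sets one at a time; the prefix
  \<open>us\<close> holds those already replaced and has to vary in the induction.\<close>

lemma pure_append_in_span:
  assumes "list_all2 (\<lambda>c S. c \<in> span S) cs Ss"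
  shows "pure (us @ cs) \<in> span {pure (us @ bs) | bs. list_all2 (\<in>) bs Ss}"
  using assms
proof (induction cs Ss arbitrary: us rule: list_all2_induct)
  case Nil
  then show ?case by (auto intro: span_base)
next
  case (Cons c cs S Ss)
  let ?T = "span {pure (us @ bs) | bs. list_all2 (\<in>) bs (S # Ss)}"
  have "c \<in> span S" using Cons by simp
  then show ?case
  proof (rule span_induct)
    show "subspace {c. pure (us @ c # cs) \<in> ?T}"
      using linear_subspace_vimage[OF multilinearD[OF multilinear_pure] subspace_span]
      by (simp add: vimage_def)
    fix c' assume c': "c' \<in> S"
    have "pure ((us @ [c']) @ cs) \<in> span {pure ((us @ [c']) @ bs) | bs. list_all2 (\<in>) bs Ss}"
      by (rule Cons.IH)
    also have "\<dots> \<subseteq> ?T"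
    proof (rule span_mono, safe)
      fix bs assume "list_all2 (\<in>) bs Ss"
      then show "\<exists>bs'. pure ((us @ [c']) @ bs) = pure (us @ bs') \<and> list_all2 (\<in>) bs' (S # Ss)"
        using c' by (intro exI[of _ "c' # bs"]) simp
    qed
    finally show "pure (us @ c' # cs) \<in> ?T" by simp
  qed
qed

section \<open>Monomials in polynomial generators\<close>

lemma polynomials_closed:
  "p \<in> polynomials I \<Longrightarrow> q \<in> polynomials I \<Longrightarrow> p + q \<in> polynomials I"
  "p \<in> polynomials I \<Longrightarrow> c *\<^sub>R p \<in> polynomials I"
  "0 \<in> polynomials I"
  using keys_add[of p q] by (auto simp: polynomials_def in_keys_iff lookup_scaleR subset_iff)

lemma single_in_polynomials: "set_mset M \<subseteq> I \<Longrightarrow> Poly_Mapping.single M c \<in> polynomials I"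
  by (auto simp: polynomials_def)

text \<open>All three claims are carried over from polynomials by the isomorphism
  \<open>\<phi>\<close> and its inverse \<open>\<psi>\<close>; a product of generators corresponds
  to the single term at the multiset of its indices.\<close>

lemma polynomial_generators_basis:
  fixes x :: "'i \<Rightarrow> 'h::real_algebra_1"
  assumes "polynomial_generators I x"
  shows "\<And>a b :: 'h. a * b = b * a"
    and "independent (monomials I x)" and "span (monomials I x) = UNIV"
proof -
  from assms obtain \<phi> where bij: "bij_betw \<phi> (polynomials I) UNIV"
    and add: "\<And>p q. p \<in> polynomials I \<Longrightarrow> q \<in> polynomials I \<Longrightarrow> \<phi> (p + q) = \<phi> p + \<phi> q"
    and mult: "\<And>p q. p \<in> polynomials I \<Longrightarrow> q \<in> polynomials I \<Longrightarrow> \<phi> (p * q) = \<phi> p * \<phi> q"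
    and scale: "\<And>p c. p \<in> polynomials I \<Longrightarrow> \<phi> (c *\<^sub>R p) = c *\<^sub>R \<phi> p"
    and one: "\<phi> 1 = 1" and gen: "\<And>i. i \<in> I \<Longrightarrow> \<phi> (Poly_Mapping.single {#i#} 1) = x i"
    unfolding polynomial_generators_def by blast
  define \<psi> where "\<psi> = the_inv_into (polynomials I) \<phi>"
  have \<psi>: "\<psi> v \<in> polynomials I" "\<phi> (\<psi> v) = v" for v
    using bij unfolding \<psi>_def bij_betw_def
    by (auto intro!: the_inv_into_into f_the_inv_into_f)
  have \<psi>\<phi>: "\<psi> (\<phi> p) = p" if "p \<in> polynomials I" for p
    using bij that unfolding \<psi>_def bij_betw_def by (auto intro!: the_inv_into_f_f)
  show "a * b = b * a" for a b :: 'h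
    using mult[of "\<psi> a" "\<psi> b"] mult[of "\<psi> b" "\<psi> a"] \<psi> by (simp add: mult.commute)
  have lin: "linear \<psi>"
  proof (rule linearI)
    fix v w :: 'h and c :: real
    show "\<psi> (v + w) = \<psi> v + \<psi> w"
      using \<psi>\<phi>[of "\<psi> v + \<psi> w"] \<psi> by (simp add: add polynomials_closed)
    show "\<psi> (c *\<^sub>R v) = c *\<^sub>R \<psi> v"
      using \<psi>\<phi>[of "c *\<^sub>R \<psi> v"] \<psi> by (simp add: scale polynomials_closed)
  qed
  have mon: "\<phi> (Poly_Mapping.single (mset is) 1) = prod_list (map x is)" if "set is \<subseteq> I" for "is"
    using that
  proof (induction "is")
    case Nil
    then show ?case by (simp add: one)
  next
    case (Cons i "is")
    have "Poly_Mapping.single (mset (i # is)) (1::real) =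
        Poly_Mapping.single {#i#} 1 * Poly_Mapping.single (mset is) 1"
      by (simp add: mult_single)
    also have "\<phi> \<dots> = x i * prod_list (map x is)"
      using Cons by (subst mult) (auto intro!: single_in_polynomials simp: gen)
    finally show ?case by simp
  qed
  show "independent (monomials I x)"
  proof (rule independent_dualI)
    fix b assume "b \<in> monomials I x"
    then obtain "is" where "is": "set is \<subseteq> I" "b = prod_list (map x is)" by (auto simp: monomials_def)
    have val: "\<psi> (prod_list (map x js)) = Poly_Mapping.single (mset js) 1" if "set js \<subseteq> I" for js
      using \<psi>\<phi>[of "Poly_Mapping.single (mset js) 1"] mon[OF that] that by (simp add: single_in_polynomials)
    \<comment> \<open>The order of the factors is irrelevant, so distinct basis elements have
      distinct multisets. Reading the coefficient at \<open>mset is\<close> is therefore the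
      functional dual to \<open>b\<close>.\<close>
    have eq: "prod_list (map x js) = prod_list (map x is)" if "set js \<subseteq> I" "mset js = mset is" for js
      using mon[OF that(1)] mon[OF "is"(1)] that(2) by simp
    have "linear (\<lambda>v. Poly_Mapping.lookup (\<psi> v) (mset is))"
      by (rule linearI) (simp_all add: linear_add[OF lin] linear_scale[OF lin] lookup_add lookup_scaleR)
    moreover have "Poly_Mapping.lookup (\<psi> b) (mset is) = 1" using "is" val by simp
    moreover have "Poly_Mapping.lookup (\<psi> b') (mset is) = 0" if b': "b' \<in> monomials I x" "b' \<noteq> b" for b'
    proof -
      obtain js where js: "set js \<subseteq> I" "b' = prod_list (map x js)" using b' by (auto simp: monomials_def)
      then have "mset js \<noteq> mset is" using eq[of js] b' "is" by auto
      then show ?thesis using val[OF js(1)] js(2) by (simp add: lookup_single when_def)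
    qed
    ultimately show "\<exists>f. linear f \<and> f b = 1 \<and> (\<forall>b'\<in>monomials I x. b' \<noteq> b \<longrightarrow> f b' = (0::real))" by blast
  qed
  show "span (monomials I x) = UNIV"
  proof -
    \<comment> \<open>Membership in \<open>polynomials I\<close> is carried along because
      \<open>\<phi>\<close> is known to be additive only on that set.\<close>
    have fin: "\<phi> (\<Sum>M\<in>F. c M *\<^sub>R Poly_Mapping.single M 1) \<in> span (monomials I x) \<and>
        (\<Sum>M\<in>F. c M *\<^sub>R Poly_Mapping.single M 1) \<in> polynomials I"
      if "finite F" "\<forall>M\<in>F. set_mset M \<subseteq> I" for F c
      using that
    proof (induction F)
      case empty
      have "\<phi> 0 = 0" using scale[of 0 0] polynomials_closed(3)[of I] by simp
      then show ?case by (simp add: span_zero polynomials_closed)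
    next
      case (insert M F)
      obtain "is" where "is": "mset is = M" using ex_mset by blast
      then have "\<phi> (Poly_Mapping.single M 1) \<in> monomials I x"
        using mon[of "is"] insert.prems by (auto simp: monomials_def)
      then have "\<phi> (Poly_Mapping.single M 1) \<in> span (monomials I x)" by (rule span_base)
      then show ?case using insert
        by (simp add: add scale single_in_polynomials polynomials_closed span_add span_scale)
    qed
    have "v \<in> span (monomials I x)" for v
    proof -
      have *: "\<psi> v = (\<Sum>M\<in>Poly_Mapping.keys (\<psi> v). Poly_Mapping.lookup (\<psi> v) M *\<^sub>R Poly_Mapping.single M 1)"
        by (rule poly_mapping_eqI)
          (simp add: lookup_sum lookup_scaleR lookup_single when_def in_keys_iff if_distrib cong: if_cong)
      have "\<forall>M\<in>Poly_Mapping.keys (\<psi> v). set_mset M \<subseteq> I"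
        using \<psi>(1)[of v] by (simp add: polynomials_def)
      from fin[OF finite_keys this] have "\<phi> (\<psi> v) \<in> span (monomials I x)"
        by (subst *) (rule conjunct1)
      then show ?thesis by (simp only: \<psi>(2))
    qed
    then show ?thesis by blast
  qed
qed

text \<open>Bounds the weight of a weak-composition by its probability, which makes the sums over
  infinitely many of them converge.\<close>

lemma multinomial_coeff_ge_1: "multinomial_coeff D \<ge> 1"
proof -
  have "prod_list (map fact D) \<le> (fact (sum_list D) :: real) \<and> prod_list (map fact D) > (0 :: real)"
  proof (induction D)
    case (Cons d D)
    have "(fact d * fact (sum_list D) :: nat) \<le> fact (d + sum_list D)"
      by (intro dvd_imp_le fact_fact_dvd_fact fact_gt_zero)
    then have "real (fact d * fact (sum_list D)) \<le> real (fact (d + sum_list D))"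
      by (simp only: of_nat_le_iff)
    then have "(fact d * fact (sum_list D) :: real) \<le> fact (d + sum_list D)" by simp
    moreover have "fact d * prod_list (map fact D) \<le> (fact d * fact (sum_list D) :: real)"
      using Cons by (intro mult_left_mono) auto
    ultimately have "fact d * prod_list (map fact D) \<le> (fact (d + sum_list D) :: real)"
      by (rule order_trans[rotated])
    then show ?case using Cons by simp
  qed simp
  then show ?thesis by (simp add: multinomial_coeff_def)
qed

lemma infsum_finite_sum:
  fixes f :: "'a \<Rightarrow> 'b \<Rightarrow> real"
  assumes "finite F" "\<And>E. f E summable_on A"
  shows "(\<Sum>\<^sub>\<infinity>D\<in>A. \<Sum>E\<in>F. f E D) = (\<Sum>E\<in>F. \<Sum>\<^sub>\<infinity>D\<in>A. f E D)"
proof -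
  have "((\<lambda>D. \<Sum>E\<in>F. f E D) has_sum (\<Sum>E\<in>F. \<Sum>\<^sub>\<infinity>D\<in>A. f E D)) A"
    using assms(1) by induction (simp_all add: has_sum_add assms(2))
  then show ?thesis by (rule infsumI)
qed

lemma pmf_summable_on: "pmf P summable_on A"
proof (rule nonneg_bdd_above_summable_on)
  show "bdd_above (sum (pmf P) ` {F. F \<subseteq> A \<and> finite F})"
    by (rule bdd_aboveI2[where M = 1])
      (auto simp: measure_pmf.prob_le_1 simp flip: measure_measure_pmf_finite)
qed simp

lemma (in graded_connected_hopf_algebra) hdegree_eq:
  assumes "v \<in> H m" "v \<noteq> 0"
  shows "hdegree H v = m"
  unfolding hdegree_def
proof (rule the_equality)
  show "k = m" if "v \<in> H k" for k
    using hcomponent_homogeneous[OF assms(1), of k] hcomponent_homogeneous[OF that, of k] assms(2)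
    by (auto split: if_splits)
qed (rule assms(1))

section \<open>Homogeneous bases, the rescaling function \<open>eta\<close> and the law of the
  chain\<close>

locale graded_basis = commutative_graded_hopf_algebra H \<Delta> \<epsilon>
  for H :: "nat \<Rightarrow> 'h::real_algebra_1 set" and \<Delta> \<epsilon> +
  fixes B :: "'h set"
  assumes independent_B: "independent B"
    and span_B: "span B = UNIV"
    and homogeneous_B: "\<And>b. b \<in> B \<Longrightarrow> \<exists>m. b \<in> H m"
begin

text \<open>Projecting the expansion of \<open>v\<close> to degree \<open>n\<close> fixes
  \<open>v\<close> and removes all basis elements of other degrees.\<close>

lemma span_B_H: "span (B \<inter> H n) = H n"
proof (intro equalityI subsetI)
  show "v \<in> H n" if "v \<in> span (B \<inter> H n)" for v
    using that span_minimal[OF _ subspace_H, of "B \<inter> H n" n] by blast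
  fix v assume v: "v \<in> H n"
  let ?r = "representation B v"
  have "v = hcomponent H n v" using v by (simp add: hcomponent_homogeneous)
  also have "\<dots> = hcomponent H n (\<Sum>b | ?r b \<noteq> 0. ?r b *\<^sub>R b)"
    using sum_nonzero_representation_eq[OF independent_B, of v] span_B by simp
  also have "\<dots> = (\<Sum>b | ?r b \<noteq> 0. ?r b *\<^sub>R hcomponent H n b)"
    by (simp add: linear_sum[OF linear_hcomponent] linear_scale[OF linear_hcomponent])
  finally have v_eq: "v = (\<Sum>b | ?r b \<noteq> 0. ?r b *\<^sub>R hcomponent H n b)" .
  have "(\<Sum>b | ?r b \<noteq> 0. ?r b *\<^sub>R hcomponent H n b) \<in> span (B \<inter> H n)"
  proof (intro span_sum span_scale)
    fix b assume "b \<in> {b. ?r b \<noteq> 0}"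
    then have "b \<in> B" by (auto dest: representation_ne_zero)
    moreover from this obtain m where "b \<in> H m" using homogeneous_B by blast
    ultimately show "hcomponent H n b \<in> span (B \<inter> H n)"
      by (auto simp: hcomponent_homogeneous span_zero intro: span_base)
  qed
  then show "v \<in> span (B \<inter> H n)" using v_eq by simp
qed

lemma independent_B_H: "independent (B \<inter> H n)"
  using independent_B by (rule independent_mono) simp

lemma finite_B_H: "finite (B \<inter> H n)"
proof -
  obtain C where "finite C" "H n = span C" using finite_dim_H by blast
  then show ?thesis using independent_span_bound[OF _ independent_B_H, of C n] by blast
qed

lemma representation_B_H: "v \<in> H n \<Longrightarrow> representation B v = representation (B \<inter> H n) v"
  using span_B_H by (intro representation_extend[OF independent_B]) auto

lemma linear_representation_B: "linear (\<lambda>v. representation B v b)"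
  using span_B by (intro linearI) (simp_all add: representation_add[OF independent_B] representation_scale[OF independent_B])

lemma linear_eq_sum_B_H:
  fixes f :: "'h \<Rightarrow> real"
  assumes "linear f" "v \<in> H n"
  shows "f v = (\<Sum>b\<in>B \<inter> H n. representation B v b * f b)"
  using linear_eq_sum_representation[OF independent_B_H finite_B_H _ assms(1), of v n] assms(2)
  by (simp add: span_B_H representation_B_H)

lemma sum_representation_B_H: "v \<in> H n \<Longrightarrow> (\<Sum>b\<in>B \<inter> H n. representation B v b *\<^sub>R b) = v"
  using sum_representation_eq[OF independent_B_H _ finite_B_H order_refl, of v n]
  by (simp add: span_B_H representation_B_H)

lemma zero_notin_B: "0 \<notin> B"
  using independent_B dependent_zero by blast

lemma tensor_basis_eq: "tensor_basis H B D = {pure bs | bs. list_all2 (\<in>) bs (map (\<lambda>d. B \<inter> H d) D)}"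
  by (simp add: tensor_basis_def list_all2_map2)

text \<open>The functional dual to a pure tensor of basis elements is the product of their
  coordinate functionals.\<close>

lemma independent_tensor_basis: "independent (tensor_basis H B D)"
proof (rule independent_dualI)
  fix b assume "b \<in> tensor_basis H B D"
  then obtain cs where b: "b = pure cs" "list_all2 (\<lambda>c d. c \<in> B \<inter> H d) cs D"
    by (auto simp: tensor_basis_def)
  define fs where "fs = map (\<lambda>c v. representation B v c) cs"
  have fs: "\<forall>f\<in>set fs. linear f" by (auto simp: fs_def linear_representation_B)
  have val: "tprod fs (pure cs') = (if cs' = cs then 1 else 0)"
    if "list_all2 (\<lambda>c d. c \<in> B \<inter> H d) cs' D" for cs'
  proof -
    have "list_all2 (\<lambda>c c'. c \<in> B \<and> c' \<in> B) cs cs'"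
      using b(2) that by (auto simp: list_all2_conv_all_nth)
    then have "length cs' = length cs \<and>
        prod_list (map2 (\<lambda>f x. f x) fs cs') = (if cs' = cs then 1 else 0)"
      unfolding fs_def
      by (induction cs cs' rule: list_all2_induct) (auto simp: representation_basis[OF independent_B])
    moreover have "length fs = length cs" by (simp add: fs_def)
    ultimately show ?thesis unfolding tprod_pure[OF fs] by (simp only: if_True simp_thms)
  qed
  have "tprod fs b = 1" using val b by simp
  moreover have "tprod fs b' = 0" if "b' \<in> tensor_basis H B D" "b' \<noteq> b" for b'
    using that val b(1) by (auto simp: tensor_basis_def)
  ultimately show "\<exists>f. linear f \<and> f b = 1 \<and> (\<forall>b'\<in>tensor_basis H B D. b' \<noteq> b \<longrightarrow> f b' = (0::real))"
    using linear_tprod[OF fs] by blast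
qed

lemma finite_tensor_basis: "finite (tensor_basis H B D)"
proof -
  have "finite {cs. list_all2 (\<lambda>c d. c \<in> B \<inter> H d) cs D}"
  proof (induction D)
    case (Cons d D)
    have "{cs. list_all2 (\<lambda>c d. c \<in> B \<inter> H d) cs (d # D)} =
        (\<lambda>(c, cs). c # cs) ` ((B \<inter> H d) \<times> {cs. list_all2 (\<lambda>c d. c \<in> B \<inter> H d) cs D})"
      by (auto simp: list_all2_Cons2)
    then show ?case using Cons finite_B_H by simp
  qed simp
  moreover have "tensor_basis H B D = pure ` {cs. list_all2 (\<lambda>c d. c \<in> B \<inter> H d) cs D}"
    by (auto simp: tensor_basis_def)
  ultimately show ?thesis by simp
qed

text \<open>The final projections put each factor into the span of the basis elements of the right
  degree, and expanding all factors gives basis tensors. Tensors of any other length are sent to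
  0.\<close>

lemma coproduct_comp_in_span: "coproduct_comp H \<Delta> \<epsilon> D v \<in> span (tensor_basis H B D)"
proof -
  let ?fs = "map ((\<circ>) tid) (map (hcomponent H) D)"
  have fs: "\<forall>f\<in>set ?fs. linear f"
    by (auto intro!: linear_compose linear_tid linear_hcomponent)
  have "tensor_maps ?fs t \<in> span (tensor_basis H B D)" for t
  proof -
    have "t \<in> span (range pure)" by (simp add: span_pure)
    then show ?thesis
    proof (rule span_induct)
      show "subspace {t. tensor_maps ?fs t \<in> span (tensor_basis H B D)}"
        using linear_subspace_vimage[OF linear_tensor_maps[OF fs] subspace_span, of "tensor_basis H B D"] 
        by (simp add: vimage_def)
      fix t :: "'h tensor" assume "t \<in> range pure"
      then obtain xs where t: "t = pure xs" by blast
      show "tensor_maps ?fs t \<in> span (tensor_basis H B D)"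
      proof (cases "length xs = length D")
        case True
        have "tensor_maps ?fs t = pure (map2 (hcomponent H) D xs)"
          using True tconcat_tid_list[of xs "map (hcomponent H) D"]
          unfolding t tensor_maps_pure[OF fs] by (simp add: zip_map1 case_prod_unfold o_def)
        moreover have "list_all2 (\<lambda>c S. c \<in> span S) (map2 (hcomponent H) D xs) (map (\<lambda>d. B \<inter> H d) D)"
          using True by (auto simp: list_all2_conv_all_nth span_B_H hcomponent_in_H)
        ultimately show ?thesis
          using pure_append_in_span[where us = "[]"] by (simp add: tensor_basis_eq)
      next
        case False
        then have "tensor_maps ?fs t = 0" unfolding t tensor_maps_pure[OF fs] by simp
        then show ?thesis by (simp only: span_zero)
      qed
    qed
  qed
  then show ?thesis by (simp add: coproduct_comp_def o_def)
qed

text \<open>For a homomorphism, multiplying the values of the factors equals evaluating their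
  product. Thus the coefficients in \<open>chi\<close> are values of \<open>\<zeta>\<close> at
  descent operators.\<close>

lemma tlift_hom_coproduct_comp:
  assumes "algebra_hom \<zeta>"
  shows "tlift (\<lambda>xs. prod_list (map \<zeta> xs)) (coproduct_comp H \<Delta> \<epsilon> D v) = \<zeta> (descent D v)"
    and "multilinear (\<lambda>xs. prod_list (map \<zeta> xs))"
proof -
  have \<zeta>: "linear \<zeta>" "\<zeta> 1 = 1" "\<And>a b. \<zeta> (a * b) = \<zeta> a * \<zeta> b"
    using assms by (auto simp: algebra_hom_def)
  have prod: "prod_list (map \<zeta> xs) = \<zeta> (prod_list xs)" for xs
    by (induction xs) (simp_all add: \<zeta>)
  show ml: "multilinear (\<lambda>xs. prod_list (map \<zeta> xs))"
    unfolding multilinear_def prod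
    using linear_compose[OF multilinearD[OF multilinear_prod_list] \<zeta>(1)] by (simp add: o_def)
  have "tlift (\<lambda>xs. prod_list (map \<zeta> xs)) t = \<zeta> (tmult t)" for t
  proof (rule linear_eq_on_tensor)
    show "linear (tlift (\<lambda>xs. prod_list (map \<zeta> xs)))" by (rule linear_tlift[OF ml])
    show "linear (\<lambda>t. \<zeta> (tmult t))"
      using linear_compose[OF linear_tlift[OF multilinear_prod_list] \<zeta>(1)] by (simp add: tmult_def o_def)
    show "tlift (\<lambda>xs. prod_list (map \<zeta> xs)) (pure xs) = \<zeta> (tmult (pure xs))" for xs
      by (simp only: tlift_pure[OF ml] tmult_def tlift_pure[OF multilinear_prod_list], rule prod)
  qed
  then show "tlift (\<lambda>xs. prod_list (map \<zeta> xs)) (coproduct_comp H \<Delta> \<epsilon> D v) = \<zeta> (descent D v)"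
    by (simp add: tmult_coproduct_comp)
qed

text \<open>Such a \<open>\<zeta>\<close> is 1 on every tensor of basis elements of degree one, so
  its tensor power adds up coefficients, which is what \<open>eta\<close> does.\<close>

lemma eta_eq_hom_descent:
  assumes "algebra_hom \<zeta>" "\<And>c. c \<in> B \<inter> H 1 \<Longrightarrow> \<zeta> c = 1" "y \<in> B \<inter> H n"
  shows "eta H \<Delta> \<epsilon> B y = \<zeta> (descent (replicate n 1) y)"
proof -
  let ?D = "replicate n (1::nat)"
  note ml = tlift_hom_coproduct_comp(2)[OF assms(1)]
  have one: "tlift (\<lambda>xs. prod_list (map \<zeta> xs)) c = 1" if "c \<in> tensor_basis H B ?D" for c
  proof -
    from that obtain cs where c: "c = pure cs" "list_all2 (\<lambda>c d. c \<in> B \<inter> H d) cs ?D"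
      by (auto simp: tensor_basis_def)
    have "\<forall>c\<in>set cs. \<zeta> c = 1"
      using c(2) assms(2) by (auto simp: list_all2_conv_all_nth in_set_conv_nth)
    then have "prod_list (map \<zeta> cs) = 1" by (induction cs) auto
    then show ?thesis unfolding c(1) tlift_pure[OF ml] .
  qed
  have deg: "hdegree H y = n" using assms(3) zero_notin_B hdegree_eq by (metis IntD1 IntD2)
  have "\<zeta> (descent ?D y) = (\<Sum>c\<in>tensor_basis H B ?D.
      representation (tensor_basis H B ?D) (coproduct_comp H \<Delta> \<epsilon> ?D y) c * tlift (\<lambda>xs. prod_list (map \<zeta> xs)) c)"
    unfolding tlift_hom_coproduct_comp(1)[OF assms(1), symmetric]
    by (rule linear_eq_sum_representation[OF independent_tensor_basis finite_tensor_basis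
          coproduct_comp_in_span linear_tlift[OF ml]])
  also have "\<dots> = eta H \<Delta> \<epsilon> B y" by (simp add: eta_def deg one Let_def)
  finally show ?thesis by simp
qed

text \<open>A weak-composition acts only through its nonzero parts, so the infinite sum can be
  grouped by the finitely many strict compositions of \<open>n\<close>.\<close>

lemma descent_operator_eq:
  assumes v: "v \<in> H n"
  shows "descent_operator H \<Delta> \<epsilon> B n P v = nsym_action (distribution_nsym n P) v"
proof -
  define w where "w D = pmf P D / multinomial_coeff D" for D
  \<comment> \<open>The total weight of the weak-compositions that reduce to
    \<open>E\<close>.\<close>
  define a where "a E = (\<Sum>\<^sub>\<infinity>D\<in>weak_compositions n. w D * Poly_Mapping.lookup (complete_nsym D) E)" for E
  have w: "0 \<le> w D" "w D \<le> pmf P D" for D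
    using multinomial_coeff_ge_1[of D] mult_left_mono[OF multinomial_coeff_ge_1[of D], of "pmf P D"]
    by (auto simp: w_def divide_le_eq)
  have lk: "Poly_Mapping.lookup (complete_nsym D) E = (if filter (\<lambda>d. d \<noteq> 0) D = E then 1 else 0)" for D E
    by (simp add: complete_nsym_def lookup_single when_def)
  have summ: "(\<lambda>D. w D * Poly_Mapping.lookup (complete_nsym D) E) summable_on weak_compositions n" for E
    by (rule summable_on_comparison_test[OF pmf_summable_on]) (use w in \<open>auto simp: lk\<close>)
  \<comment> \<open>The regrouping for real-valued \<open>r\<close>, applied below to each
    coordinate of the operator.\<close>
  have coef: "(\<Sum>\<^sub>\<infinity>D\<in>weak_compositions n. w D * r (filter (\<lambda>d. d \<noteq> 0) D)) =
      (\<Sum>E\<in>compositions n. a E * r E)" for r :: "nat list \<Rightarrow> real"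
  proof -
    have "(\<Sum>\<^sub>\<infinity>D\<in>weak_compositions n. w D * r (filter (\<lambda>d. d \<noteq> 0) D)) =
        (\<Sum>\<^sub>\<infinity>D\<in>weak_compositions n. \<Sum>E\<in>compositions n. w D * Poly_Mapping.lookup (complete_nsym D) E * r E)"
    proof (rule infsum_cong)
      fix D assume D: "D \<in> weak_compositions n"
      have "sum_list (filter (\<lambda>d. d \<noteq> 0) D) = sum_list D" by (induction D) auto
      then have "filter (\<lambda>d. d \<noteq> 0) D \<in> compositions n"
        using D by (auto simp: compositions_def weak_compositions_def)
      then have "(\<Sum>E\<in>compositions n. if filter (\<lambda>d. d \<noteq> 0) D = E then w D * r E else 0) =
          w D * r (filter (\<lambda>d. d \<noteq> 0) D)"
        by (simp add: finite_compositions)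
      moreover have "w D * Poly_Mapping.lookup (complete_nsym D) E * r E =
          (if filter (\<lambda>d. d \<noteq> 0) D = E then w D * r E else 0)" for E by (simp add: lk)
      ultimately show "w D * r (filter (\<lambda>d. d \<noteq> 0) D) =
          (\<Sum>E\<in>compositions n. w D * Poly_Mapping.lookup (complete_nsym D) E * r E)" by simp
    qed
    also have "\<dots> = (\<Sum>E\<in>compositions n. \<Sum>\<^sub>\<infinity>D\<in>weak_compositions n. w D * Poly_Mapping.lookup (complete_nsym D) E * r E)"
      by (rule infsum_finite_sum[OF finite_compositions summable_on_cmult_left[OF summ]])
    also have "\<dots> = (\<Sum>E\<in>compositions n. a E * r E)"
      unfolding a_def by (intro sum.cong refl infsum_cmult_left summ)
    finally show ?thesis .
  qed
  have in_H: "descent E v \<in> H n" if "E \<in> compositions n" for E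
    using descent_in_H[of E v] that by (simp add: compositions_def)
  have "descent_operator H \<Delta> \<epsilon> B n P v = (\<Sum>y\<in>B \<inter> H n. (\<Sum>\<^sub>\<infinity>D\<in>weak_compositions n.
      w D * representation B (descent (filter (\<lambda>d. d \<noteq> 0) D) v) y) *\<^sub>R y)"
    by (simp only: descent_operator_def tmult_coproduct_comp w_def descent_filter)
  also have "\<dots> = (\<Sum>y\<in>B \<inter> H n. \<Sum>E\<in>compositions n. a E *\<^sub>R representation B (descent E v) y *\<^sub>R y)"
    by (simp only: coef[of "\<lambda>E. representation B (descent E v) _"] scaleR_sum_left scaleR_scaleR)
  also have "\<dots> = (\<Sum>E\<in>compositions n. a E *\<^sub>R (\<Sum>y\<in>B \<inter> H n. representation B (descent E v) y *\<^sub>R y))"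
    unfolding scaleR_sum_right by (rule sum.swap)
  also have "\<dots> = (\<Sum>E\<in>compositions n. a E *\<^sub>R descent E v)"
    using in_H by (intro sum.cong refl) (simp add: sum_representation_B_H)
  also have "\<dots> = nsym_action (distribution_nsym n P) v"
    unfolding distribution_nsym_def a_def w_def
    by (simp add: linear_sum[OF linear_nsym_action_left] linear_scale[OF linear_nsym_action_left]
        nsym_action_complete)
  finally show ?thesis .
qed

lemma nsym_action_distribution_in_H: "nsym_action (distribution_nsym n P) v \<in> H n"
  unfolding distribution_nsym_def
  using descent_in_H
  by (auto simp: linear_sum[OF linear_nsym_action_left] linear_scale[OF linear_nsym_action_left]
      nsym_action_complete compositions_def intro!: subspace_sum subspace_scale subspace_H)

text \<open>The transition matrix is the matrix of the operator rescaled by \<open>eta\<close>, as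
  in a Doob transform: along a path the factors \<open>eta\<close> telescope and only the end points
  remain.\<close>

lemma chain_distribution:
  assumes mc: "markov_chain M X (B \<inter> H n) (transition_matrix H \<Delta> \<epsilon> B n P) x\<^sub>0"
    and x\<^sub>0: "x\<^sub>0 \<in> B \<inter> H n" and eta: "\<And>b. b \<in> B \<Longrightarrow> eta H \<Delta> \<epsilon> B b > 0"
    and y: "y \<in> B \<inter> H n"
  shows "\<P>(\<omega> in M. X t \<omega> = y) = eta H \<Delta> \<epsilon> B y / eta H \<Delta> \<epsilon> B x\<^sub>0 *
    representation B ((nsym_action (distribution_nsym n P) ^^ t) x\<^sub>0) y"
  using y
proof (induction t arbitrary: y)
  case 0
  interpret prob_space M using mc by (simp add: markov_chain_def)
  have X: "X 0 \<in> measurable M (count_space (B \<inter> H n))" using mc by (simp add: markov_chain_def)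
  have ev: "{\<omega> \<in> space M. X 0 \<omega> = w} \<in> sets M" if "w \<in> B \<inter> H n" for w
    using measurable_sets[OF X, of "{w}"] that by (simp add: vimage_def Int_def conj_commute)
  have p: "prob {\<omega> \<in> space M. X 0 \<omega> = x\<^sub>0} = 1" using mc by (simp add: markov_chain_def)
  show ?case
  proof (cases "y = x\<^sub>0")
    case True
    then show ?thesis using p eta[of x\<^sub>0] x\<^sub>0 by (simp add: representation_basis[OF independent_B])
  next
    case False
    have "prob {\<omega> \<in> space M. X 0 \<omega> = y} \<le> prob (space M - {\<omega> \<in> space M. X 0 \<omega> = x\<^sub>0})"
      using ev[OF x\<^sub>0] False by (intro finite_measure_mono) auto
    also have "\<dots> = 0" using prob_compl[OF ev[OF x\<^sub>0]] p by simp
    finally have "prob {\<omega> \<in> space M. X 0 \<omega> = y} = 0" by (simp add: measure_le_0_iff)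
    then show ?thesis using False x\<^sub>0 by (simp add: representation_basis[OF independent_B])
  qed
next
  case (Suc t)
  let ?T = "nsym_action (distribution_nsym n P)" and ?e = "eta H \<Delta> \<epsilon> B"
  let ?v = "(?T ^^ t) x\<^sub>0"
  have v: "?v \<in> H n" using x\<^sub>0 by (cases t) (auto simp: nsym_action_distribution_in_H)
  have lin: "linear (\<lambda>v. representation B (?T v) y)"
    using linear_compose[OF linear_nsym_action linear_representation_B] by (simp add: o_def)
  have "\<P>(\<omega> in M. X (Suc t) \<omega> = y) =
      (\<Sum>w\<in>B \<inter> H n. \<P>(\<omega> in M. X t \<omega> = w) * transition_matrix H \<Delta> \<epsilon> B n P w y)"
    by (rule markov_chain_step[OF mc finite_B_H Suc.prems])
  also have "\<dots> = (\<Sum>w\<in>B \<inter> H n. ?e y / ?e x\<^sub>0 * (representation B ?v w * representation B (?T w) y))"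
  proof (intro sum.cong refl)
    fix w assume w: "w \<in> B \<inter> H n"
    \<comment> \<open>The factor \<open>?e w\<close> of the induction hypothesis cancels the
      denominator in the transition from \<open>w\<close>.\<close>
    then have "?e w \<noteq> 0" using eta[of w] by auto
    then show "\<P>(\<omega> in M. X t \<omega> = w) * transition_matrix H \<Delta> \<epsilon> B n P w y =
        ?e y / ?e x\<^sub>0 * (representation B ?v w * representation B (?T w) y)"
      using w by (simp add: Suc.IH transition_matrix_def descent_operator_eq)
  qed
  also have "\<dots> = ?e y / ?e x\<^sub>0 * representation B (?T ?v) y"
    by (simp add: linear_eq_sum_B_H[OF lin v] sum_distrib_left)
  finally show ?case by simp
qed

end

section \<open>The absorption probability\<close>

theorem theorem3p12:
  fixes H :: "nat \<Rightarrow> 'h::real_algebra_1 set"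
    and \<Delta> :: "'h \<Rightarrow> 'h tensor"
    and \<epsilon> \<zeta> :: "'h \<Rightarrow> real"
    and I :: "'i set" and x :: "'i \<Rightarrow> 'h"
    and B A :: "'h set"
    and n t :: nat
    and P :: "nat list pmf"
    and M :: "'w measure" and X :: "nat \<Rightarrow> 'w \<Rightarrow> 'h" and x\<^sub>0 :: 'h
  assumes "graded_connected_hopf_algebra H \<Delta> \<epsilon>"
    and "polynomial_generators I x"
    and "\<And>i. i \<in> I \<Longrightarrow> \<exists>d>0. x i \<in> H d"
    and "B = monomials I x"
    and "set_pmf P \<subseteq> weak_compositions n"
    and "state_space_basis H \<Delta> \<epsilon> B P"
    and "x\<^sub>0 \<in> B \<inter> H n"
    and "markov_chain M X (B \<inter> H n) (transition_matrix H \<Delta> \<epsilon> B n P) x\<^sub>0"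
    and "A = {prod_list (map x is) | is. length is = n \<and> set is \<subseteq> {i \<in> I. hdegree H (x i) = 1}}"
    and "algebra_hom \<zeta>"
    and "\<And>i. i \<in> I \<Longrightarrow> \<zeta> (x i) = (if hdegree H (x i) = 1 then 1 else 0)"
    and "t \<ge> 1"
  shows "\<P>(\<omega> in M. X t \<omega> \<in> A) =
           fact n / eta H \<Delta> \<epsilon> B x\<^sub>0 *
           nsym_qsym_pairing (internal_power (distribution_nsym n P) t) (chi H \<Delta> \<epsilon> \<zeta> n x\<^sub>0)"
proof -
  have hopf: "graded_connected_hopf_algebra H \<Delta> \<epsilon>" by fact
  note gens = polynomial_generators_basis[OF assms(2)]
  have comm: "commutative_graded_hopf_algebra H \<Delta> \<epsilon>"
    by (intro commutative_graded_hopf_algebra.intro commutative_graded_hopf_algebra_axioms.intro hopf gens(1))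
  interpret commutative_graded_hopf_algebra H \<Delta> \<epsilon> by (rule comm)
  define deg where "deg i = hdegree H (x i)" for i
  have x_in_B: "x i \<in> B" if "i \<in> I" for i
    using that unfolding assms(4) monomials_def by (intro CollectI exI[of _ "[i]"]) simp
  \<comment> \<open>A nonzero homogeneous element has only one degree, which makes
    \<open>hdegree\<close> meaningful on generators and monomials.\<close>
  have "0 \<notin> B"
  proof
    assume "0 \<in> B"
    then have "dependent B" by (rule dependent_zero)
    then show False using gens(2) assms(4) by simp
  qed
  then have deg: "x i \<in> H (deg i)" "deg i > 0" if i: "i \<in> I" for i
  proof -
    obtain d where d: "d > 0" "x i \<in> H d" using assms(3)[OF i] by blast
    moreover have "x i \<noteq> 0" using x_in_B[OF that] \<open>0 \<notin> B\<close> by auto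
    ultimately have "deg i = d" unfolding deg_def using hdegree_eq by simp
    then show "x i \<in> H (deg i)" "deg i > 0" using d by simp_all
  qed
  have prod_in_H: "prod_list (map x is) \<in> H (sum_list (map deg is))" if "set is \<subseteq> I" for "is"
    using that
  proof (induction "is")
    case (Cons i "is")
    then show ?case using mult_graded[OF deg(1)[of i], of "prod_list (map x is)"] by simp
  qed (simp add: one_in_H0)
  interpret graded_basis H \<Delta> \<epsilon> B
  proof (intro graded_basis.intro comm graded_basis_axioms.intro)
    show "independent B" "span B = UNIV" unfolding assms(4) by (rule gens)+
    show "\<exists>m. b \<in> H m" if "b \<in> B" for b
      using that prod_in_H unfolding assms(4) monomials_def by blast
  qed
  have hom: "linear \<zeta>" "\<zeta> 1 = 1" "\<And>a b. \<zeta> (a * b) = \<zeta> a * \<zeta> b"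
    using assms(10) by (auto simp: algebra_hom_def)
  have \<zeta>_prod: "\<zeta> (prod_list (map x is)) = (if \<forall>i\<in>set is. deg i = 1 then 1 else 0)" if "set is \<subseteq> I" for "is"
    using that by (induction "is") (auto simp: hom assms(11) deg_def)
  have sum_deg: "sum_list (map deg is) = length is" if "\<forall>i\<in>set is. deg i = 1" for "is"
    using that by (induction "is") auto
  \<comment> \<open>On basis elements of degree \<open>n\<close> the functional
    \<open>\<zeta>\<close> is the indicator of \<open>A\<close>: if all generators in a monomial of
    degree \<open>n\<close> have degree one, there are exactly \<open>n\<close> of them.\<close>
  have A_eq: "y \<in> A \<longleftrightarrow> \<zeta> y = 1" "y \<notin> A \<longleftrightarrow> \<zeta> y = 0" if y: "y \<in> B \<inter> H n" for y
  proof -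
    obtain "is" where "is": "set is \<subseteq> I" "y = prod_list (map x is)"
      using y by (auto simp: assms(4) monomials_def)
    have "y \<noteq> 0" using y \<open>0 \<notin> B\<close> by auto
    then have n: "sum_list (map deg is) = n"
      using hdegree_eq[of y n] hdegree_eq[of y "sum_list (map deg is)"] prod_in_H[OF "is"(1)] y "is"(2) by simp
    have 1: "\<zeta> y = 1" if "y \<in> A"
      using that unfolding assms(9) by (auto simp: \<zeta>_prod subset_iff deg_def)
    have 2: "y \<in> A" if "\<forall>i\<in>set is. deg i = 1"
    proof -
      have "sum_list (map deg is) = length is" using that by (rule sum_deg)
      then show ?thesis using n that "is" unfolding assms(9) deg_def
        by (intro CollectI exI[of _ "is"]) auto
    qed
    have val: "\<zeta> y = (if \<forall>i\<in>set is. deg i = 1 then 1 else 0)" using \<zeta>_prod[OF "is"(1)] "is"(2) by simp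
    have "(y \<in> A \<longleftrightarrow> \<zeta> y = 1) \<and> (y \<notin> A \<longleftrightarrow> \<zeta> y = 0)"
    proof (cases "\<forall>i\<in>set is. deg i = 1")
      case True
      have "\<zeta> y = 1" unfolding val by (rule if_P[OF True])
      then show ?thesis using 2[OF True] by simp
    next
      case False
      have "\<zeta> y = 0" unfolding val by (rule if_not_P[OF False])
      then show ?thesis using 1 by fastforce
    qed
    then show "y \<in> A \<longleftrightarrow> \<zeta> y = 1" "y \<notin> A \<longleftrightarrow> \<zeta> y = 0" by blast+
  qed
  have A_prod: "\<exists>as. set as \<subseteq> H 1 \<and> length as = n \<and> y = prod_list as" if "y \<in> A" for y
  proof -
    obtain "is" where "is": "length is = n" "set is \<subseteq> {i \<in> I. deg i = 1}" "y = prod_list (map x is)"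
      using \<open>y \<in> A\<close> by (auto simp: assms(9) deg_def)
    then have "set (map x is) \<subseteq> H 1" using deg(1) by fastforce
    then show ?thesis using "is" by (intro exI[of _ "map x is"]) simp
  qed
  have A_sub: "A \<subseteq> B \<inter> H n"
  proof
    fix y assume "y \<in> A"
    then obtain "is" where "is": "length is = n" "set is \<subseteq> {i \<in> I. deg i = 1}" "y = prod_list (map x is)"
      by (auto simp: assms(9) deg_def)
    then have "sum_list (map deg is) = n" using sum_deg[of "is"] by (simp add: subset_iff)
    moreover have "set is \<subseteq> I" using "is" by blast
    ultimately show "y \<in> B \<inter> H n" using prod_in_H[of "is"] "is"(3) by (auto simp: assms(4) monomials_def)
  qed
  \<comment> \<open>Generators have positive degree, so every factor of a monomial of degree 1 has
    degree 1.\<close>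
  have \<zeta>_degree_1: "\<zeta> c = 1" if c: "c \<in> B \<inter> H 1" for c
  proof -
    obtain "is" where "is": "set is \<subseteq> I" "c = prod_list (map x is)"
      using c by (auto simp: assms(4) monomials_def)
    have "c \<noteq> 0" using c \<open>0 \<notin> B\<close> by auto
    then have "sum_list (map deg is) = 1"
      using hdegree_eq[of c 1] hdegree_eq[of c "sum_list (map deg is)"] prod_in_H[OF "is"(1)] c "is"(2) by simp
    then have "deg i = 1" if "i \<in> set is" for i
      using member_le_sum_list[of "deg i" "map deg is"] deg(2)[of i] that "is"(1)
      by (simp add: subset_iff)
    then show ?thesis using \<zeta>_prod[OF "is"(1)] "is"(2) by simp
  qed
  \<comment> \<open>\<open>eta\<close> is constant on \<open>A\<close>, so it can be taken out of
    the sum over \<open>A\<close>; this is the origin of \<open>fact n\<close>.\<close>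
  have eta_A: "eta H \<Delta> \<epsilon> B y = fact n" if "y \<in> A" for y
  proof -
    obtain as where as: "set as \<subseteq> H 1" "length as = n" "y = prod_list as" using A_prod \<open>y \<in> A\<close> by blast
    have y: "y \<in> B \<inter> H n" using A_sub \<open>y \<in> A\<close> by blast
    have "eta H \<Delta> \<epsilon> B y = \<zeta> (descent (replicate n 1) y)"
      by (rule eta_eq_hom_descent[OF assms(10) \<zeta>_degree_1 y])
    also have "\<dots> = \<zeta> (fact n *\<^sub>R y)" using descent_ones_prod_list[OF as(1)] as by simp
    also have "\<dots> = fact n" using A_eq(1)[OF y] \<open>y \<in> A\<close> by (simp add: linear_scale[OF hom(1)])
    finally show ?thesis .
  qed
  have eta_pos: "\<And>b. b \<in> B \<Longrightarrow> eta H \<Delta> \<epsilon> B b > 0"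
    using assms(6) by (simp add: state_space_basis_def)
  interpret prob_space M using assms(8) by (simp add: markov_chain_def)
  let ?a = "distribution_nsym n P"
  let ?v = "(nsym_action ?a ^^ t) x\<^sub>0"
  have v: "?v \<in> H n" using assms(7) by (cases t) (auto simp: nsym_action_distribution_in_H)
  have finA: "finite A" using A_sub finite_B_H finite_subset by blast
  have ev: "{\<omega> \<in> space M. X t \<omega> = w} \<in> sets M" if "w \<in> B \<inter> H n" for w
  proof -
    have "X t \<in> measurable M (count_space (B \<inter> H n))" using assms(8) by (simp add: markov_chain_def)
    from measurable_sets[OF this, of "{w}"] show ?thesis
      using that by (simp add: vimage_def Int_def conj_commute)
  qed
  have A_Union: "{\<omega> \<in> space M. X t \<omega> \<in> A} = (\<Union>y\<in>A. {\<omega> \<in> space M. X t \<omega> = y})" by auto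
  have "\<P>(\<omega> in M. X t \<omega> \<in> A) = (\<Sum>y\<in>A. \<P>(\<omega> in M. X t \<omega> = y))"
    unfolding A_Union
    by (rule finite_measure_finite_Union[OF finA])
      (use ev A_sub in \<open>auto simp: disjoint_family_on_def\<close>)
  also have "\<dots> = (\<Sum>y\<in>A. fact n / eta H \<Delta> \<epsilon> B x\<^sub>0 * representation B ?v y)"
  proof (intro sum.cong refl)
    fix y assume y: "y \<in> A"
    then have "y \<in> B \<inter> H n" using A_sub by blast
    from chain_distribution[OF assms(8,7) eta_pos this]
    show "\<P>(\<omega> in M. X t \<omega> = y) = fact n / eta H \<Delta> \<epsilon> B x\<^sub>0 * representation B ?v y"
      by (simp add: eta_A[OF y])
  qed
  also have "\<dots> = fact n / eta H \<Delta> \<epsilon> B x\<^sub>0 * (\<Sum>y\<in>A. representation B ?v y)"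
    by (simp add: sum_distrib_left)
  \<comment> \<open>Weighting by \<open>\<zeta>\<close> extends the sum from \<open>A\<close> to the
    whole basis of degree \<open>n\<close>, where it becomes the value of the linear functional
    \<open>\<zeta>\<close> at \<open>?v\<close>.\<close>
  also have "(\<Sum>y\<in>A. representation B ?v y) = (\<Sum>y\<in>B \<inter> H n. representation B ?v y * \<zeta> y)"
  proof (rule sum.mono_neutral_cong_left[OF finite_B_H A_sub])
    show "\<forall>y\<in>B \<inter> H n - A. representation B ?v y * \<zeta> y = 0"
    proof
      fix y assume "y \<in> B \<inter> H n - A"
      then show "representation B ?v y * \<zeta> y = 0" using A_eq(2)[of y] by simp
    qed
    fix y assume y: "y \<in> A"
    then have "y \<in> B \<inter> H n" using A_sub by blast
    then show "representation B ?v y = representation B ?v y * \<zeta> y" using A_eq(1)[of y] y by simp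
  qed
  also have "\<dots> = \<zeta> ?v" by (rule linear_eq_sum_B_H[OF hom(1) v, symmetric])
  also have "?v = nsym_action (internal_power ?a t) x\<^sub>0"
    using assms(12) by (rule nsym_action_internal_power[symmetric])
  also have "\<zeta> \<dots> = nsym_qsym_pairing (internal_power ?a t) (chi H \<Delta> \<epsilon> \<zeta> n x\<^sub>0)"
  proof -
    \<comment> \<open>For a word whose parts do not sum to \<open>n\<close> both sides are 0: it has
      no term in \<open>chi\<close>, and its operator vanishes on degree \<open>n\<close>.\<close>
    have coord: "Poly_Mapping.lookup (qsym_coords (chi H \<Delta> \<epsilon> \<zeta> n x\<^sub>0)) E = \<zeta> (descent E x\<^sub>0)"
      if "E \<in> Poly_Mapping.keys (internal_power ?a t)" for E
    proof -
      have E: "0 \<notin> set E"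
        using internal_power_strict[OF distribution_nsym_strict] that by (auto simp: strict_nsym_def)
      have "Poly_Mapping.lookup (qsym_coords (chi H \<Delta> \<epsilon> \<zeta> n x\<^sub>0)) E =
          (if E \<in> compositions n then \<zeta> (descent E x\<^sub>0) else 0)"
        unfolding chi_def tlift_hom_coproduct_comp(1)[OF assms(10)]
        by (rule lookup_qsym_coords[OF finite_compositions]) (simp add: compositions_def)
      moreover have "descent E x\<^sub>0 = 0" if "E \<notin> compositions n"
        using that E assms(7) by (intro descent_eq_0[of _ n]) (auto simp: compositions_def)
      ultimately show ?thesis using linear_0[OF hom(1)] by auto
    qed
    show ?thesis
      unfolding nsym_action_def nsym_qsym_pairing_def
      using coord by (simp add: linear_sum[OF hom(1)] linear_scale[OF hom(1)])
  qed
  finally show ?thesis .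
qed

end
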